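(* Let $\lambda>-1/2$, $\lambda\ne0$, let $C_n^\lambda$ be the Gegenbauer polynomials and \[ M_n^\lambda(s)=\int_0^1\frac{C_n^\lambda(x)\,x^{s-1}}{(1-x^2)^{3/4-\lambda/2}}\,dx \] ($\Re s>0$ for $n$ even, $\Re s>-1$ for $n$ odd). Then for every integer $n\ge 0$, \[ M_{2n}^\lambda(s)=M_0^\lambda(s)\sum_{r=0}^n\frac{(-1)^{n-r}2^{2r}\binom{n+r+\lambda-1}{n+r}\binom{n+r}{2r}\binom{\frac{s-2}{2}+r}{r}\binom{n+\frac{s+\lambda}{2}-\frac34}{n-r}}{\binom{n}{r}\binom{n+\frac{s+\lambda}{2}-\frac34}{n}} =M_0^\lambda(s)\sum_{r=0}^n\frac{(-1)^{n-r}2^{2r}\binom{n+r+\lambda-1}{n+r}\binom{n+r}{2r}\binom{\frac{s-2}{2}+r}{r}}{\binom{\frac{s+\lambda}{2}-\frac34+r}{r}} \] \[ =(-1)^nM_0^\lambda(s)\binom{\lambda+n-1}{n}\,{}_3F_2\left(-n,\lambda+n,\tfrac s2;\tfrac12,\tfrac\lambda2+\tfrac s2+\tfrac14;1\right), \] and \[ M_{2n+1}^\lambda(s)=M_0^\lambda(s+1)\sum_{r=0}^n\frac{(-1)^{n-r}2^{2r+1}\binom{n+r+\lambda}{n+r+1}\binom{n+r+1}{2r+1}\binom{\frac{s-1}{2}+r}{r}\binom{n+\frac{s+\lambda}{2}-\frac14}{n-r}}{\binom{n}{r}\binom{n+\frac{s+\lambda}{2}-\frac14}{n}} =M_0^\lambda(s+1)\sum_{r=0}^n\frac{(-1)^{n-r}2^{2r+1}\binom{n+r+\lambda}{n+r+1}\binom{n+r+1}{2r+1}\binom{\frac{s-1}{2}+r}{r}}{\binom{\frac{s+\lambda}{2}-\frac14+r}{r}}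 \] \[ =(-1)^n\,2\,M_0^\lambda(s+1)(n+1)\binom{\lambda+n}{n+1}\,{}_3F_2\left(-n,\lambda+n+1,\tfrac s2+\tfrac12;\tfrac32,\tfrac{\lambda+s}{2}+\tfrac34;1\right), \] where $M_0^\lambda(s)=\dfrac{\Gamma\left(\frac\lambda2+\frac14\right)\Gamma\left(\frac s2\right)}{2\Gamma\left(\frac{s+\lambda}{2}+\frac14\right)}$. Moreover, for general $n\ge0$, \[ M_n^\lambda(s)=\frac{(2\lambda)_n\,\Gamma\left(\frac\lambda2+\frac14\right)\Gamma\left(\frac{s+n}{2}\right)}{2(n!)\,\Gamma\left(\frac{s+n+\lambda}{2}+\frac14\right)}\,{}_3F_2\left(\tfrac\lambda2+\tfrac14,\tfrac{1-n}{2},-\tfrac n2;\tfrac12+\lambda,1-\tfrac{n+s}{2};1\right). \]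
   Context: $C_n^\lambda(x)=\sum_{r=0}^{\lfloor n/2\rfloor}(-1)^r\binom{n-r}{r}\binom{n-r-1+\lambda}{n-r}(2x)^{n-2r}$. For complex $x$ and integer $k\ge0$, $\binom{x}{k}=x(x-1)\cdots(x-k+1)/k!$ (generalized binomial coefficient). $(a)_n=\Gamma(a+n)/\Gamma(a)$ is the Pochhammer symbol and ${}_3F_2$ is the generalized hypergeometric function (here terminating). *)

theory Defs
  imports "HOL-Analysis.Analysis"
begin

definition gegenbauer :: "nat \<Rightarrow> real \<Rightarrow> real \<Rightarrow> real" where
  "gegenbauer n l x =
     (\<Sum>r\<le>n div 2. (- 1) ^ r * real ((n - r) choose r)
        * ((real (n - r) - 1 + l) gchoose (n - r)) * (2 * x) ^ (n - 2 * r))"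

definition mellin_integrand :: "nat \<Rightarrow> real \<Rightarrow> complex \<Rightarrow> real \<Rightarrow> complex" where
  "mellin_integrand n l s x =
     of_real (gegenbauer n l x) * of_real x powr (s - 1)
       / of_real ((1 - x\<^sup>2) powr (3 / 4 - l / 2))"

definition gegenbauer_mellin :: "nat \<Rightarrow> real \<Rightarrow> complex \<Rightarrow> complex" where
  "gegenbauer_mellin n l s = (LBINT x:{0<..<1}. mellin_integrand n l s x)"

(* Used for terminating series only: beyond termination the numerator of every coefficient
   vanishes, and such a coefficient is 0 even if its denominator vanishes too (0 / 0 = 0). *)
definition hypergeo_3F2 ::
    "complex \<Rightarrow> complex \<Rightarrow> complex \<Rightarrow> complex \<Rightarrow> complex \<Rightarrow> complex \<Rightarrow> complex" where
  "hypergeo_3F2 a\<^sub>1 a\<^sub>2 a\<^sub>3 b\<^sub>1 b\<^sub>2 z = eval_fps (fps_hypergeo [a\<^sub>1, a\<^sub>2, a\<^sub>3] [b\<^sub>1, b\<^sub>2] 1) z"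

end

theory Submission
  imports Defs
begin

text \<open>
  Everything reduces to the integral $\int_0^1 x^{s-1}(1-x^2)^{b-1}\,dx$, evaluated for complex \<open>s\<close> as
  $\Gamma(b)\Gamma(s/2)/(2\Gamma(s/2+b))$. Integration by parts relates \<open>b\<close> to \<open>b + 1\<close>, so it suffices
  to know the asymptotics for \<open>b + n\<close> as \<open>n\<close> tends to infinity; these agree with the explicit integrals for
  \<open>1 + n\<close>, since the difference is dominated by a difference of integrals at \<open>Re s\<close> with integer exponents,
  and Gauss' limit for the Gamma function finishes the argument.

  The binomial sums come from the monomial expansion of the Gegenbauer polynomial. The last formula comes from
  its expansion in $x^{n-2k}(x^2-1)^k$, a consequence of the Chu--Vandermonde identity.
\<close>

text \<open>With t = x^2 the integral is half of Euler's B(s/2, b), but at complex \<open>s\<close>.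
  Since \<open>b\<close> stays real, the recurrence and the comparison move \<open>b\<close> alone,
  and the weight (1 - x^2)^(b - 1) is monotone in it. The Gegenbauer weight is the case b = l/2 +
  1/4, so l > -1/2 says exactly that b > 0. The two expansions suit two kinds of answer. Monomials
  leave \<open>b\<close> fixed and shift s/2 by integers, so M_0 factors out, at s or s + 1, and
  quotients of Pochhammer symbols remain. In x^(n-2k) (1 - x^2)^k the first Gamma argument is (s +
  n)/2 - k and the second is b + k; their sum does not depend on k, so one Gamma denominator serves
  all terms. Only its products with x^(n-2k), where n - 2k >= 1, are; hence integrability is argued
  term by term.\<close>

section \<open>Binomial coefficients, Pochhammer symbols and terminating series\<close>

lemma gchoose_pochhammer:
  fixes a :: "'a::field_char_0"
  shows "(a + of_nat k) gchoose k = pochhammer (a + 1) k / fact k"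
  by (simp add: gbinomial_pochhammer' algebra_simps)

lemma gchoose_pochhammer_minus_one:
  fixes a :: "'a::field_char_0"
  shows "(of_nat k + a - 1) gchoose k = pochhammer a k / fact k"
proof -
  have "of_nat k + a - 1 = (a - 1) + of_nat k"
    by simp
  then show ?thesis
    using gchoose_pochhammer[of "a - 1" k] by (simp only: diff_add_cancel)
qed

lemma minus_one_power_diff:
  assumes "r \<le> n"
  shows "(- 1 :: 'a::ring_1) ^ (n - r) = (- 1) ^ n * (- 1) ^ r"
proof -
  have "(- 1 :: 'a) ^ n = (- 1) ^ (n - r) * (- 1) ^ r"
    using assms by (simp flip: power_add)
  moreover have "(- 1 :: 'a) ^ r * (- 1) ^ r = 1"
    by (simp flip: power_add)
  ultimately show ?thesis
    by (simp add: mult.assoc)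
qed

lemma pochhammer_Re_pos_neq_0:
  assumes "Re z > 0"
  shows "pochhammer z n \<noteq> 0"
  using assms by (auto simp: pochhammer_eq_0_iff)

text \<open>The hypothesis concerns the product of the three upper symbols because in the formula
  for general degree the parity of \<open>n\<close> decides which of them vanishes. The lower
  parameters are unrestricted: past \<open>N\<close> a term is 0 even over a vanishing
  denominator.\<close>

lemma hypergeo_3F2_terminating:
  assumes "\<And>k. k > N \<Longrightarrow> pochhammer a\<^sub>1 k * pochhammer a\<^sub>2 k * pochhammer a\<^sub>3 k = 0"
  shows "hypergeo_3F2 a\<^sub>1 a\<^sub>2 a\<^sub>3 b\<^sub>1 b\<^sub>2 1
    = (\<Sum>k\<le>N. pochhammer a\<^sub>1 k * pochhammer a\<^sub>2 k * pochhammer a\<^sub>3 k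
          / (pochhammer b\<^sub>1 k * pochhammer b\<^sub>2 k * fact k))"
proof -
  have "hypergeo_3F2 a\<^sub>1 a\<^sub>2 a\<^sub>3 b\<^sub>1 b\<^sub>2 1
    = (\<Sum>k. pochhammer a\<^sub>1 k * pochhammer a\<^sub>2 k * pochhammer a\<^sub>3 k
          / (pochhammer b\<^sub>1 k * pochhammer b\<^sub>2 k * fact k))"
    by (simp add: hypergeo_3F2_def eval_fps_def)
  also have "\<dots> = (\<Sum>k\<le>N. pochhammer a\<^sub>1 k * pochhammer a\<^sub>2 k * pochhammer a\<^sub>3 k
          / (pochhammer b\<^sub>1 k * pochhammer b\<^sub>2 k * fact k))"
    by (rule suminf_finite) (use assms in auto)
  finally show ?thesis .
qed

lemma pochhammer_half_mult_fact:
  "pochhammer (1 / 2 :: 'a::field_char_0) k * fact k = fact (2 * k) / 4 ^ k"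
  by (simp add: fact_double power_mult)

text \<open>Evaluating (1/2)_(k+1) twice, by splitting off its first factor 1/2 or its last factor k
  + 1/2, trades 3/2 for 1/2.\<close>

lemma pochhammer_three_halves_mult_fact:
  "pochhammer (3 / 2 :: 'a::field_char_0) k * fact k = fact (2 * k + 1) / 4 ^ k"
proof -
  have "pochhammer (1 / 2 :: 'a) (Suc k) = 1 / 2 * pochhammer (3 / 2) k"
    by (simp add: pochhammer_rec)
  then have "pochhammer (3 / 2 :: 'a) k = 2 * pochhammer (1 / 2) (Suc k)"
    by (simp add: field_simps)
  also have "\<dots> = (2 * of_nat k + 1) * pochhammer (1 / 2) k"
    by (simp add: pochhammer_Suc algebra_simps)
  finally have "pochhammer (3 / 2 :: 'a) k = (2 * of_nat k + 1) * pochhammer (1 / 2) k" .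
  then have "pochhammer (3 / 2 :: 'a) k * fact k = (2 * of_nat k + 1) * (pochhammer (1 / 2) k * fact k)"
    by simp
  then show ?thesis
    unfolding pochhammer_half_mult_fact by (simp add: algebra_simps)
qed

section \<open>Upper parameters -n, -m/2 and (1 - m)/2; Chu-Vandermonde summation\<close>

lemma pochhammer_minus_of_nat:
  assumes "k \<le> n"
  shows "pochhammer (- of_nat n :: 'a::field_char_0) k = (- 1) ^ k * fact n / fact (n - k)"
proof -
  have "of_nat (n choose k) = (-1) ^ k * pochhammer (- of_nat n :: 'a) k / fact k"
    by (simp add: binomial_gbinomial gbinomial_pochhammer)
  then have "pochhammer (- of_nat n :: 'a) k = (-1) ^ k * (fact k * of_nat (n choose k))"
    by (simp add: field_simps)
  then show ?thesis
    using assms by (simp add: binomial_fact)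
qed

text \<open>Duplication formula at -m/2. It shows without a parity split that the product vanishes
  once 2k > m, although only one of the two factors does.\<close>

lemma pochhammer_minus_of_nat_double:
  "4 ^ k * (pochhammer (- of_nat m / 2 :: 'a::field_char_0) k * pochhammer ((1 - of_nat m) / 2) k)
    = pochhammer (- of_nat m) (2 * k)"
proof -
  have "- of_nat m / 2 + 1 / 2 = (1 - of_nat m :: 'a) / 2"
    by (simp add: diff_divide_distrib)
  moreover have "of_nat (2 ^ (2 * k)) = (4 ^ k :: 'a)"
    by (simp add: power_mult)
  ultimately show ?thesis
    using pochhammer_double[of "- of_nat m / 2 :: 'a" k] by (simp only: mult.assoc) simp
qed

lemma pochhammer_minus_half:
  assumes "2 * k \<le> m"
  shows "pochhammer (- of_nat m / 2 :: 'a::field_char_0) k * pochhammer ((1 - of_nat m) / 2) k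
    = fact m / (4 ^ k * fact (m - 2 * k))"
proof -
  have "4 ^ k * (pochhammer (- of_nat m / 2 :: 'a) k * pochhammer ((1 - of_nat m) / 2) k)
      = fact m / fact (m - 2 * k)"
    unfolding pochhammer_minus_of_nat_double using pochhammer_minus_of_nat[OF assms] by simp
  then show ?thesis
    by (simp add: field_simps)
qed

text \<open>Chu--Vandermonde for the upper parameters \<open>- m / 2\<close> and \<open>(1 - m) / 2\<close>: whichever of them is
  a nonpositive integer terminates the series. The factor \<^term>\<open>pochhammer (2 * \<mu>) m\<close> is kept on the left
  because it may vanish.\<close>

lemma half_Vandermonde:
  fixes \<mu> :: "'a::field_char_0"
  assumes nz: "\<And>k. pochhammer (\<mu> + 1 / 2) k \<noteq> 0"
  shows "pochhammer (2 * \<mu>) m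
      * (\<Sum>k\<le>m div 2. 1 / (4 ^ k * fact k * fact (m - 2 * k) * pochhammer (\<mu> + 1 / 2) k))
    = 2 ^ m * pochhammer \<mu> m / fact m"
proof -
  have S: "fact m * (\<Sum>k\<le>m div 2. 1 / (4 ^ k * fact k * fact (m - 2 * k) * pochhammer (\<mu> + 1 / 2) k))
     = (\<Sum>k\<le>m div 2. pochhammer (- of_nat m / 2) k * pochhammer ((1 - of_nat m) / 2) k
          / (fact k * pochhammer (\<mu> + 1 / 2) k))" (is "_ = ?S")
    unfolding sum_distrib_left
  proof (rule sum.cong)
    fix k assume "k \<in> {..m div 2}"
    then have "2 * k \<le> m"
      by auto
    show "fact m * (1 / (4 ^ k * fact k * fact (m - 2 * k) * pochhammer (\<mu> + 1 / 2) k))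
      = pochhammer (- of_nat m / 2) k * pochhammer ((1 - of_nat m) / 2) k
          / (fact k * pochhammer (\<mu> + 1 / 2) k)"
      unfolding pochhammer_minus_half[OF \<open>2 * k \<le> m\<close>] by simp
  qed simp
  have "pochhammer (2 * \<mu>) m * ?S = 2 ^ m * pochhammer \<mu> m"
  proof (cases "even m")
    case True
    then obtain p where m: "m = 2 * p" ..
    have "?S = (\<Sum>k=0..p. pochhammer (1 / 2 - of_nat p) k * pochhammer (- of_nat p) k
        / (of_nat (fact k) * pochhammer (\<mu> + 1 / 2) k))"
      by (simp add: m atMost_atLeast0 diff_divide_distrib mult.commute)
    also have "\<dots> = pochhammer (\<mu> + 1 / 2 - (1 / 2 - of_nat p)) p / pochhammer (\<mu> + 1 / 2) p"
      by (rule Vandermonde_pochhammer) (use nz[of p] in \<open>auto simp: pochhammer_eq_0_iff\<close>)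
    finally have "?S = pochhammer (\<mu> + of_nat p) p / pochhammer (\<mu> + 1 / 2) p"
      by simp
    \<comment> \<open>Duplication supplies the symbol that cancels the Vandermonde denominator; its
      other symbol is completed to length \<open>m\<close> by the Vandermonde numerator.\<close>
    moreover have "pochhammer (2 * \<mu>) m = 2 ^ m * pochhammer \<mu> p * pochhammer (\<mu> + 1 / 2) p"
      by (simp add: m pochhammer_double)
    moreover have "pochhammer \<mu> m = pochhammer \<mu> p * pochhammer (\<mu> + of_nat p) p"
      by (simp add: m mult_2 pochhammer_product')
    ultimately show ?thesis
      using nz[of p] by simp
  next
    case False
    then obtain p where m: "m = 2 * p + 1"
      by (elim oddE)
    have p: "(1 - of_nat m) / 2 = (- of_nat p :: 'a)" "- of_nat m / 2 = (- 1 / 2 - of_nat p :: 'a)" "m div 2 = p"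
      by (auto simp: m field_simps)
    have "?S = (\<Sum>k=0..p. pochhammer (- 1 / 2 - of_nat p) k * pochhammer (- of_nat p) k
        / (of_nat (fact k) * pochhammer (\<mu> + 1 / 2) k))"
      by (simp only: p atMost_atLeast0 of_nat_fact)
    also have "\<dots> = pochhammer (\<mu> + 1 / 2 - (- 1 / 2 - of_nat p)) p / pochhammer (\<mu> + 1 / 2) p"
      by (rule Vandermonde_pochhammer) (use nz[of p] in \<open>auto simp: pochhammer_eq_0_iff\<close>)
    also have "\<mu> + 1 / 2 - (- 1 / 2 - of_nat p) = \<mu> + of_nat p + 1"
      by (simp add: field_simps)
    finally have S': "?S = pochhammer (\<mu> + of_nat p + 1) p / pochhammer (\<mu> + 1 / 2) p" .
    \<comment> \<open>The unpaired last factor 2(\<mu> + p) fills the gap between (\<mu>)_p and the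
      Vandermonde numerator, which starts at \<mu> + p + 1.\<close>
    have "pochhammer (2 * \<mu>) m = pochhammer (2 * \<mu>) (2 * p) * (2 * (\<mu> + of_nat p))"
      by (simp add: m pochhammer_Suc)
    also have "\<dots> = 2 ^ m * pochhammer \<mu> p * pochhammer (\<mu> + 1 / 2) p * (\<mu> + of_nat p)"
      unfolding pochhammer_double by (simp add: m)
    finally have "pochhammer (2 * \<mu>) m
        = 2 ^ m * pochhammer \<mu> p * pochhammer (\<mu> + 1 / 2) p * (\<mu> + of_nat p)" .
    moreover have "pochhammer \<mu> m = pochhammer \<mu> p * ((\<mu> + of_nat p) * pochhammer (\<mu> + of_nat p + 1) p)"
      using pochhammer_product'[of \<mu> p "Suc p"] by (simp add: m mult_2 pochhammer_rec)
    ultimately show ?thesis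
      using nz[of p] unfolding S' by simp
  qed
  then have "fact m * (pochhammer (2 * \<mu>) m
      * (\<Sum>k\<le>m div 2. 1 / (4 ^ k * fact k * fact (m - 2 * k) * pochhammer (\<mu> + 1 / 2) k)))
    = 2 ^ m * pochhammer \<mu> m"
    by (simp only: mult.left_commute[of "fact m"] S)
  then show ?thesis
    by (simp add: nonzero_eq_divide_eq mult.commute)
qed

section \<open>Two expansions of the Gegenbauer polynomial\<close>

lemma gegenbauer_pochhammer:
  "gegenbauer n l x = (\<Sum>r\<le>n div 2.
     (- 1) ^ r * 2 ^ (n - 2 * r) * pochhammer l (n - r) / (fact r * fact (n - 2 * r)) * x ^ (n - 2 * r))"
  unfolding gegenbauer_def
proof (rule sum.cong)
  fix r assume "r \<in> {..n div 2}"
  then have r: "2 * r \<le> n"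
    by auto
  have "(real (n - r) - 1 + l) gchoose (n - r) = pochhammer l (n - r) / fact (n - r)"
    using gchoose_pochhammer_minus_one[of "n - r" l] by (simp add: algebra_simps)
  moreover have "real ((n - r) choose r) = fact (n - r) / (fact r * fact (n - 2 * r))"
  proof -
    have "n - r - r = n - 2 * r"
      by simp
    then show ?thesis
      using r by (subst binomial_fact) auto
  qed
  ultimately show "(- 1) ^ r * real ((n - r) choose r) * ((real (n - r) - 1 + l) gchoose (n - r)) * (2 * x) ^ (n - 2 * r)
    = (- 1) ^ r * 2 ^ (n - 2 * r) * pochhammer l (n - r) / (fact r * fact (n - 2 * r)) * x ^ (n - 2 * r)"
    by (simp add: power_mult_distrib)
qed simp

text \<open>Compare coefficients of x^(n-2r). After expanding (x^2 - 1)^k and putting k = r + j, the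
  coefficient sum is \<open>half_Vandermonde\<close> with \<mu> = l + r and m = n - 2r. The bound on
  \<open>l\<close> keeps the lower symbols nonzero.\<close>

lemma gegenbauer_expansion:
  assumes l: "l > - 1 / 2"
  shows "gegenbauer n l x = (\<Sum>k\<le>n div 2.
    pochhammer (2 * l) n / (4 ^ k * fact k * fact (n - 2 * k) * pochhammer (l + 1 / 2) k)
      * (x ^ (n - 2 * k) * (x\<^sup>2 - 1) ^ k))"
proof -
  define N where "N = n div 2"
  define d where "d k = pochhammer (2 * l) n / (4 ^ k * fact k * fact (n - 2 * k) * pochhammer (l + 1 / 2) k)" for k
  have pos: "pochhammer (l + 1 / 2 + real r) k \<noteq> 0" for r k
    using l by (auto simp: pochhammer_eq_0_iff)
  have swap: "(\<Sum>k\<le>N. \<Sum>r\<le>k. a k r) = (\<Sum>r\<le>N. \<Sum>k=r..N. a k r)"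
    for a :: "nat \<Rightarrow> nat \<Rightarrow> real" and N
    by (induction N) (auto simp: sum.distrib)
  have expand: "x ^ (n - 2 * k) * (x\<^sup>2 - 1) ^ k
      = (\<Sum>r\<le>k. (- 1) ^ r * real (k choose r) * x ^ (n - 2 * r))" if "k \<le> N" for k
  proof -
    have "(x\<^sup>2 - 1) ^ k = (\<Sum>r\<le>k. real (k choose r) * (- 1) ^ r * (x\<^sup>2) ^ (k - r))"
      using binomial_ring[of "-1" "x\<^sup>2" k] by simp
    moreover have "x ^ (n - 2 * k) * (x\<^sup>2) ^ (k - r) = x ^ (n - 2 * r)" if "r \<le> k" for r
    proof -
      have "n - 2 * k + 2 * (k - r) = n - 2 * r"
        using \<open>r \<le> k\<close> \<open>k \<le> N\<close> by (auto simp: N_def)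
      then show ?thesis
        by (metis power_add power_mult)
    qed
    ultimately show ?thesis
      by (auto simp: sum_distrib_left intro!: sum.cong)
  qed
  have coeff: "(\<Sum>k=r..N. d k * real (k choose r))
      = 2 ^ (n - 2 * r) * pochhammer l (n - r) / (fact r * fact (n - 2 * r))" if "r \<le> N" for r
  proof -
    define m where "m = n - 2 * r"
    define \<mu> where "\<mu> = l + real r"
    have n: "n = 2 * r + m" and m2: "m div 2 = N - r"
      using that by (auto simp: m_def N_def)
    \<comment> \<open>(2l)_n is split at 2r. By duplication the head contains (l + 1/2)_r, which
      cancels in the denominator of \<open>d\<close>; the tail is the factor (2 \<mu>)_m on the left
      of \<open>half_Vandermonde\<close>.\<close>
    have "pochhammer (2 * l) n = pochhammer (2 * l) (2 * r) * pochhammer (2 * l + real (2 * r)) m"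
      unfolding n by (rule pochhammer_product')
    then have p2: "pochhammer (2 * l) n
        = 4 ^ r * pochhammer l r * pochhammer (l + 1 / 2) r * pochhammer (2 * \<mu>) m"
      by (simp add: pochhammer_double power_mult \<mu>_def distrib_left)
    have "(\<Sum>k=r..N. d k * real (k choose r)) = (\<Sum>j\<le>m div 2. d (r + j) * real ((r + j) choose r))"
      unfolding m2 by (rule sum.reindex_bij_witness[of _ "\<lambda>j. r + j" "\<lambda>k. k - r"]) (use that in auto)
    also have "\<dots> = (\<Sum>j\<le>m div 2. pochhammer l r / fact r * (pochhammer (2 * \<mu>) m
        * (1 / (4 ^ j * fact j * fact (m - 2 * j) * pochhammer (\<mu> + 1 / 2) j))))"
    proof (rule sum.cong)
      fix j
      have b: "real ((r + j) choose r) = fact (r + j) / (fact r * fact j)"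
        by (simp add: binomial_fact)
      have "l + 1 / 2 + real r = \<mu> + 1 / 2"
        by (simp add: \<mu>_def)
      then have p: "pochhammer (l + 1 / 2) (r + j) = pochhammer (l + 1 / 2) r * pochhammer (\<mu> + 1 / 2) j"
        by (simp only: pochhammer_product')
      have f: "n - 2 * (r + j) = m - 2 * j"
        by (simp add: n)
      have nz: "pochhammer (l + 1 / 2) r \<noteq> 0"
        using pos[of 0] by simp
      show "d (r + j) * real ((r + j) choose r) = pochhammer l r / fact r * (pochhammer (2 * \<mu>) m
        * (1 / (4 ^ j * fact j * fact (m - 2 * j) * pochhammer (\<mu> + 1 / 2) j)))"
        unfolding d_def b p f p2 using nz by (simp add: power_add)
    qed simp
    also have "\<dots> = pochhammer l r / fact r * (2 ^ m * pochhammer \<mu> m / fact m)"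
      unfolding sum_distrib_left[symmetric]
      using half_Vandermonde[of \<mu> m] pos[of r] by (simp add: \<mu>_def add_ac)
    also have "pochhammer l (n - r) = pochhammer l r * pochhammer \<mu> m"
      unfolding n \<mu>_def using pochhammer_product'[of l r m] by (simp add: mult_2)
    then have "pochhammer l r / fact r * (2 ^ m * pochhammer \<mu> m / fact m)
        = 2 ^ (n - 2 * r) * pochhammer l (n - r) / (fact r * fact (n - 2 * r))"
      by (simp add: m_def)
    finally show ?thesis .
  qed
  have "(\<Sum>k\<le>N. d k * (x ^ (n - 2 * k) * (x\<^sup>2 - 1) ^ k))
      = (\<Sum>k\<le>N. \<Sum>r\<le>k. d k * ((- 1) ^ r * real (k choose r) * x ^ (n - 2 * r)))"
    by (rule sum.cong) (auto simp: expand sum_distrib_left)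
  also have "\<dots> = (\<Sum>r\<le>N. \<Sum>k=r..N. d k * ((- 1) ^ r * real (k choose r) * x ^ (n - 2 * r)))"
    by (rule swap)
  also have "\<dots> = (\<Sum>r\<le>N. (- 1) ^ r * (\<Sum>k=r..N. d k * real (k choose r)) * x ^ (n - 2 * r))"
    by (simp add: sum_distrib_left sum_distrib_right mult_ac)
  also have "\<dots> = gegenbauer n l x"
    unfolding gegenbauer_pochhammer N_def[symmetric] by (rule sum.cong) (auto simp: coeff)
  finally show ?thesis
    by (simp add: d_def N_def)
qed

section \<open>The integral of x^(s-1) (1 - x^2)^(b-1): convergence and recurrences\<close>

definition beta_kernel :: "complex \<Rightarrow> real \<Rightarrow> real \<Rightarrow> complex" where
  "beta_kernel s b x = of_real x powr (s - 1) * of_real ((1 - x\<^sup>2) powr (b - 1))"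

definition beta_mellin :: "complex \<Rightarrow> real \<Rightarrow> complex" where
  "beta_mellin s b = (LBINT x:{0<..<1}. beta_kernel s b x)"

lemma sq_less_one:
  fixes x :: real
  assumes "x \<in> {0<..<1}"
  shows "x\<^sup>2 < 1"
  using assms by (simp add: power_less_one_iff)

lemma beta_kernel_of_real:
  assumes "x \<in> {0<..<1}"
  shows "beta_kernel (of_real a) b x = of_real (x powr (a - 1) * (1 - x\<^sup>2) powr (b - 1))"
proof -
  have "complex_of_real x powr (of_real (a - 1)) = of_real (x powr (a - 1))"
    using assms by (intro powr_of_real) auto
  then show ?thesis
    by (simp add: beta_kernel_def)
qed

lemma norm_beta_kernel:
  assumes "x \<in> {0<..<1}"
  shows "norm (beta_kernel s b x) = x powr (Re s - 1) * (1 - x\<^sup>2) powr (b - 1)"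
  using assms by (simp add: beta_kernel_def norm_mult norm_powr_real_powr)

lemma beta_kernel_measurable:
  "set_borel_measurable lborel {0<..<1} (beta_kernel s b)"
proof -
  have nz: "1 - x\<^sup>2 \<noteq> 0" if "x \<in> {0<..<1}" for x :: real
    using sq_less_one[OF that] by simp
  have "continuous_on {0<..<1} (beta_kernel s b)"
    unfolding beta_kernel_def
    by (intro continuous_on_mult continuous_on_of_real continuous_on_powr continuous_on_powr_complex
        continuous_intros) (use nz in auto)
  then show ?thesis
    using borel_measurable_continuous_on_indicator[of "{0<..<1}" "beta_kernel s b"]
    by (simp add: set_borel_measurable_def)
qed

text \<open>Factor 1 - x^2 as (1 + x)(1 - x). The first factor lies between 1 and 2, so its power is
  at most 2^|b-1| for either sign of b - 1; what remains is the integrand of a Beta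
  integral.\<close>

lemma set_integrable_beta_kernel:
  assumes "Re s > 0" "b > 0"
  shows "set_integrable lborel {0<..<1} (beta_kernel s b)"
proof -
  have "set_integrable lborel {0..1} (\<lambda>t. t powr (Re s - 1) * (1 - t) powr (b - 1))"
    using integrable_Beta assms by blast
  then have "set_integrable lborel {0<..<1} (\<lambda>t. t powr (Re s - 1) * (1 - t) powr (b - 1))"
    by (rule set_integrable_subset) auto
  then have *: "set_integrable lborel {0<..<1}
      (\<lambda>t. 2 powr \<bar>b - 1\<bar> * (t powr (Re s - 1) * (1 - t) powr (b - 1)))"
    by simp
  show ?thesis
  proof (rule set_integrable_bound[OF * beta_kernel_measurable], rule AE_I2, rule impI)
    fix x :: real assume x: "x \<in> {0<..<1}"
    have "(1 + x) powr (b - 1) \<le> (1 + x) powr \<bar>b - 1\<bar>"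
      using x by (intro powr_mono) auto
    also have "\<dots> \<le> 2 powr \<bar>b - 1\<bar>"
      using x by (intro powr_mono2) auto
    finally have le: "(1 + x) powr (b - 1) \<le> 2 powr \<bar>b - 1\<bar>" .
    have "1 - x\<^sup>2 = (1 + x) * (1 - x)"
      by (simp add: algebra_simps power2_eq_square)
    then have "norm (beta_kernel s b x)
        = (1 + x) powr (b - 1) * (x powr (Re s - 1) * (1 - x) powr (b - 1))"
      using x by (simp add: norm_beta_kernel powr_mult)
    also have "\<dots> \<le> 2 powr \<bar>b - 1\<bar> * (x powr (Re s - 1) * (1 - x) powr (b - 1))"
      by (intro mult_right_mono le) auto
    finally show "norm (beta_kernel s b x)
        \<le> norm (2 powr \<bar>b - 1\<bar> * (x powr (Re s - 1) * (1 - x) powr (b - 1)))"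
      by simp
  qed
qed

lemma beta_kernel_mult_power:
  assumes "x \<in> {0<..<1}"
  shows "of_real (x ^ k) * beta_kernel s b x = beta_kernel (s + of_nat k) b x"
proof -
  have "complex_of_real x powr (s - 1 + of_nat k) = of_real x powr (s - 1) * of_real x powr of_nat k"
    by (rule powr_add)
  then show ?thesis
    using assms by (simp add: beta_kernel_def powr_nat' algebra_simps)
qed

lemma beta_kernel_mult_one_minus_power:
  assumes "x \<in> {0<..<1}"
  shows "of_real ((1 - x\<^sup>2) ^ k) * beta_kernel s b x = beta_kernel s (b + of_nat k) x"
proof -
  have "(1 - x\<^sup>2) powr (b + of_nat k - 1) = (1 - x\<^sup>2) powr (b - 1) * (1 - x\<^sup>2) ^ k"
    using sq_less_one[OF assms] by (simp add: algebra_simps flip: powr_add powr_realpow)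
  then show ?thesis
    by (simp add: beta_kernel_def)
qed

text \<open>Multiplying the kernel by x^2 raises \<open>s\<close> by two, multiplying it by 1 - x^2
  raises \<open>b\<close> by one.\<close>

lemma beta_mellin_diff:
  assumes "Re s > 0" "b > 0"
  shows "beta_mellin s b - beta_mellin (s + 2) b = beta_mellin s (b + 1)"
proof -
  have "beta_mellin s b - beta_mellin (s + 2) b
      = (LBINT x:{0<..<1}. beta_kernel s b x - beta_kernel (s + 2) b x)"
    unfolding beta_mellin_def
    by (rule set_integral_diff(2)[symmetric]; rule set_integrable_beta_kernel) (use assms in auto)
  also have "\<dots> = beta_mellin s (b + 1)"
    unfolding beta_mellin_def
  proof (rule set_lebesgue_integral_cong)
    show "\<forall>x. x \<in> {0<..<1} \<longrightarrow>
        beta_kernel s b x - beta_kernel (s + 2) b x = beta_kernel s (b + 1) x"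
      using beta_kernel_mult_power[of _ 2 s b] beta_kernel_mult_one_minus_power[of _ 1 s b]
      by (auto simp: algebra_simps)
  qed simp
  finally show ?thesis .
qed

lemma has_vector_derivative_of_real_powr:
  assumes "x > 0"
  shows "((\<lambda>x. complex_of_real x powr s) has_vector_derivative s * of_real x powr (s - 1)) (at x)"
proof -
  have "complex_of_real x \<notin> \<real>\<^sub>\<le>\<^sub>0"
    using assms by simp
  then show ?thesis
    by (intro has_vector_derivative_real_field has_field_derivative_powr)
qed

text \<open>Integration by parts: both sides are the two terms of the derivative of
  \<^term>\<open>\<lambda>x. of_real x powr s * of_real ((1 - x\<^sup>2) powr b)\<close>, which vanishes at 0 and 1.\<close>

lemma beta_mellin_by_parts:
  assumes "Re s > 0" "b > 0"
  shows "s * beta_mellin s (b + 1) = 2 * of_real b * beta_mellin (s + 2) b"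
proof -
  define F where "F x = complex_of_real x powr s * of_real ((1 - x\<^sup>2) powr b)" for x
  define f where "f x = s * beta_kernel s (b + 1) x - 2 * of_real b * beta_kernel (s + 2) b x" for x
  have int: "set_integrable lborel {0<..<1} (\<lambda>x. s * beta_kernel s (b + 1) x)"
    "set_integrable lborel {0<..<1} (\<lambda>x. 2 * of_real b * beta_kernel (s + 2) b x)"
    by (rule set_integrable_mult_right, rule set_integrable_beta_kernel; use assms in simp)+
  \<comment> \<open>The hypotheses enter at the endpoints: Re s > 0 gives continuity at 0, where the
    first power is 0, and b > 0 gives it at 1 for the second.\<close>
  have "continuous_on {0..1} (\<lambda>x. complex_of_real x powr s)"
    by (intro continuous_on_powr_complex continuous_intros) (use assms in auto)
  moreover have "continuous_on {0..1} (\<lambda>x::real. (1 - x\<^sup>2) powr b)"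
    using assms by (intro continuous_on_powr' continuous_intros) (auto simp: power_le_one)
  ultimately have cont: "continuous_on {0..1} F"
    unfolding F_def by (intro continuous_on_mult continuous_on_of_real)
  have deriv: "(F has_vector_derivative f x) (at x)" if x: "x \<in> {0<..<1}" for x
  proof -
    have 1: "((\<lambda>x. complex_of_real x powr s) has_vector_derivative
         s * of_real x powr (s - 1)) (at x)"
      using x by (intro has_vector_derivative_of_real_powr) auto
    have "((\<lambda>x. (1 - x\<^sup>2) powr b) has_real_derivative (- 2 * b * x * (1 - x\<^sup>2) powr (b - 1))) (at x)"
      using sq_less_one[OF x]
      by (auto intro!: derivative_eq_intros simp: powr_diff)
    then have 2: "((\<lambda>x. complex_of_real ((1 - x\<^sup>2) powr b)) has_vector_derivative
         of_real (- 2 * b * x * (1 - x\<^sup>2) powr (b - 1))) (at x)"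
      by (intro has_vector_derivative_of_real) (simp add: has_real_derivative_iff_has_vector_derivative)
    have x1: "complex_of_real x powr (1 + s) = of_real x * of_real x powr s"
      using x by (simp add: powr_add)
    have "(F has_vector_derivative (of_real x powr s * of_real (- 2 * b * x * (1 - x\<^sup>2) powr (b - 1))
        + s * of_real x powr (s - 1) * of_real ((1 - x\<^sup>2) powr b))) (at x)"
      unfolding F_def by (rule has_vector_derivative_mult[OF 1 2])
    also have "of_real x powr s * of_real (- 2 * b * x * (1 - x\<^sup>2) powr (b - 1))
        + s * of_real x powr (s - 1) * of_real ((1 - x\<^sup>2) powr b) = f x"
      by (simp add: f_def beta_kernel_def x1 algebra_simps)
    finally show ?thesis .
  qed
  have "(f has_integral (F 1 - F 0)) {0..1}"
    by (rule fundamental_theorem_of_calculus_interior[OF _ cont deriv]) auto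
  then have "(f has_integral 0) {0<..<1}"
    using assms by (simp add: F_def has_integral_Icc_iff_Ioo)
  moreover have "set_integrable lborel {0<..<1} f"
    unfolding f_def by (intro set_integral_diff int)
  ultimately have "(LBINT x:{0<..<1}. f x) = 0"
    by (simp add: set_borel_integral_eq_integral(2) integral_unique)
  moreover have "(LBINT x:{0<..<1}. f x)
      = s * beta_mellin s (b + 1) - 2 * of_real b * beta_mellin (s + 2) b"
    unfolding f_def beta_mellin_def
    by (subst set_integral_diff(2)[OF int]) (simp only: set_integral_mult_right)
  ultimately show ?thesis
    by simp
qed

text \<open>The integral at \<open>s + 2\<close> is eliminated between the difference identity and
  the integration by parts; what remains changes only \<open>b\<close>.\<close>

lemma beta_mellin_rec:
  assumes "Re s > 0" "b > 0"
  shows "of_real b * beta_mellin s b = (s / 2 + of_real b) * beta_mellin s (b + 1)"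
proof -
  have "beta_mellin s b = beta_mellin s (b + 1) + beta_mellin (s + 2) b"
    using beta_mellin_diff[OF assms] by (simp add: algebra_simps)
  then have "2 * (of_real b * beta_mellin s b) = 2 * ((s / 2 + of_real b) * beta_mellin s (b + 1))"
    using beta_mellin_by_parts[OF assms] by (simp add: algebra_simps)
  then show ?thesis
    by simp
qed

lemma beta_mellin_pochhammer:
  assumes "Re s > 0" "b > 0"
  shows "pochhammer (of_real b) n * beta_mellin s b
    = pochhammer (s / 2 + of_real b) n * beta_mellin s (b + of_nat n)"
proof (induction n)
  case (Suc n)
  have rec: "of_real (b + n) * beta_mellin s (b + n)
      = (s / 2 + of_real (b + n)) * beta_mellin s (b + n + 1)"
    using assms by (intro beta_mellin_rec) auto
  have "pochhammer (of_real b) (Suc n) * beta_mellin s b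
      = of_real (b + n) * (pochhammer (of_real b) n * beta_mellin s b)"
    by (simp add: pochhammer_Suc)
  also have "\<dots> = pochhammer (s / 2 + of_real b) n * (of_real (b + n) * beta_mellin s (b + n))"
    by (simp add: Suc)
  also have "\<dots> = pochhammer (s / 2 + of_real b) (Suc n) * beta_mellin s (b + of_nat (Suc n))"
    unfolding rec by (simp add: pochhammer_Suc add_ac)
  finally show ?case .
qed simp

lemma beta_mellin_one:
  assumes "Re s > 0"
  shows "beta_mellin s 1 = 1 / s"
proof -
  have "s \<noteq> 0"
    using assms by auto
  have cont: "continuous_on {0..1} (\<lambda>x. complex_of_real x powr s)"
    by (intro continuous_on_powr_complex continuous_intros) (use assms in auto)
  have "((\<lambda>x. s * complex_of_real x powr (s - 1)) has_integral (of_real 1 powr s - of_real 0 powr s)) {0..1}"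
    by (rule fundamental_theorem_of_calculus_interior[OF _ cont]) (auto simp: has_vector_derivative_of_real_powr)
  then have "((\<lambda>x. complex_of_real x powr (s - 1)) has_integral 1 / s) {0..1}"
    using has_integral_divide[of _ 1 "{0..1}" s] \<open>s \<noteq> 0\<close> by fastforce
  then have "((\<lambda>x. complex_of_real x powr (s - 1)) has_integral 1 / s) {0<..<1}"
    by (simp add: has_integral_Icc_iff_Ioo)
  moreover have "beta_kernel s 1 x = complex_of_real x powr (s - 1)" if "x \<in> {0<..<1}" for x
    using sq_less_one[OF that] by (simp add: beta_kernel_def)
  ultimately have "(beta_kernel s 1 has_integral 1 / s) {0<..<1}"
    using has_integral_cong[of "{0<..<1}" "beta_kernel s 1"] by auto
  then show ?thesis
    unfolding beta_mellin_def
    using set_borel_integral_eq_integral(2)[OF set_integrable_beta_kernel[of s 1]] assms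
    by (simp add: integral_unique)
qed

text \<open>The recurrence climbs from the elementary case b = 1, where the integral is 1/s; the
  factor s/2 lengthens the symbol from (s/2 + 1)_n to (s/2)_(n+1) and leaves the 2 in the
  denominator.\<close>

lemma beta_mellin_one_plus_nat:
  assumes "Re s > 0"
  shows "beta_mellin s (1 + real n) = fact n / (2 * pochhammer (s / 2) (Suc n))"
proof -
  have "s \<noteq> 0"
    using assms by auto
  have nz: "pochhammer (s / 2 + 1) n \<noteq> 0"
    using assms by (intro pochhammer_Re_pos_neq_0) auto
  have "fact n * (1 / s) = pochhammer (s / 2 + 1) n * beta_mellin s (1 + real n)"
    using beta_mellin_pochhammer[of s 1 n] assms
    by (simp add: beta_mellin_one pochhammer_fact)
  then show ?thesis
    using nz \<open>s \<noteq> 0\<close> by (simp add: pochhammer_rec field_simps)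
qed

section \<open>Asymptotics for large b and evaluation by Gamma functions\<close>

text \<open>Since 0 < 1 - x^2 < 1, the difference of the two weights is nonnegative, and |x^(s-1)| =
  x^(Re s - 1). The right side is therefore the integral of the norm of the integrand on the left.
  This is the substitute at complex \<open>s\<close> for monotonicity in \<open>b\<close>.\<close>

lemma norm_beta_mellin_diff_le:
  assumes "Re s > 0" "0 < b" "b \<le> c"
  shows "norm (beta_mellin s b - beta_mellin s c)
    \<le> Re (beta_mellin (of_real (Re s)) b - beta_mellin (of_real (Re s)) c)"
proof -
  let ?d = "\<lambda>s x. beta_kernel s b x - beta_kernel s c x"
  have diff: "beta_mellin t b - beta_mellin t c = (LBINT x:{0<..<1}. ?d t x)"
    and int: "set_integrable lborel {0<..<1} (?d t)" if "Re t > 0" for t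
    unfolding beta_mellin_def
    using that assms by (auto intro!: set_integral_diff set_integral_diff(2)[symmetric] set_integrable_beta_kernel)
  have eq: "?d (of_real (Re s)) x = of_real (norm (?d s x))" if x: "x \<in> {0<..<1}" for x
  proof -
    have "(1 - x\<^sup>2) powr (c - 1) \<le> (1 - x\<^sup>2) powr (b - 1)"
      using sq_less_one[OF x] assms by (intro powr_mono') auto
    moreover have "?d s x = of_real x powr (s - 1) * of_real ((1 - x\<^sup>2) powr (b - 1) - (1 - x\<^sup>2) powr (c - 1))"
      by (simp add: beta_kernel_def algebra_simps)
    ultimately have "norm (?d s x) = x powr (Re s - 1) * ((1 - x\<^sup>2) powr (b - 1) - (1 - x\<^sup>2) powr (c - 1))"
      using x by (simp only: norm_mult norm_of_real) (simp add: norm_powr_real_powr)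
    then show ?thesis
      using x by (simp only: beta_kernel_of_real right_diff_distrib flip: of_real_diff)
  qed
  have "norm (beta_mellin s b - beta_mellin s c) \<le> (LBINT x:{0<..<1}. norm (?d s x))"
    unfolding diff[OF assms(1)] by (rule set_integral_norm_bound[OF int[OF assms(1)]])
  also have "\<dots> = Re (LBINT x:{0<..<1}. of_real (norm (?d s x)))"
    unfolding set_integral_complex_of_real by simp
  also have "(LBINT x:{0<..<1}. complex_of_real (norm (?d s x))) = (LBINT x:{0<..<1}. ?d (of_real (Re s)) x)"
    by (rule set_lebesgue_integral_cong) (use eq in auto)
  also have "\<dots> = beta_mellin (of_real (Re s)) b - beta_mellin (of_real (Re s)) c"
    using assms by (subst diff) auto
  finally show ?thesis .
qed

text \<open>For k = 0 the n-th term is half of Gauss' sequence for Gamma(s/2). Passing from k to k +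
  1 multiplies it by 1 - (s/2)/d with d = s/2 + 1 + k + n, by the recurrence, and this factor tends
  to 1.\<close>

lemma beta_mellin_LIMSEQ_nat:
  assumes "Re s > 0"
  shows "(\<lambda>n. exp (s / 2 * of_real (ln (real n))) * beta_mellin s (1 + real n + real k))
    \<longlonglongrightarrow> Gamma (s / 2) / 2"
proof (induction k)
  case 0
  have "Gamma_series (s / 2) n / 2
      = exp (s / 2 * of_real (ln (real n))) * beta_mellin s (1 + real n + real 0)" for n
    using beta_mellin_one_plus_nat[OF assms, of n] by (simp add: Gamma_series_def mult.commute)
  then show ?case
    using tendsto_divide[OF Gamma_series_LIMSEQ[of "s / 2"] tendsto_const[of 2]] by simp
next
  case (Suc k)
  have "filterlim (\<lambda>n. (s / 2 + 1 + of_nat k) + complex_of_nat n) at_infinity sequentially"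
    by (intro tendsto_add_filterlim_at_infinity[OF tendsto_const] tendsto_of_nat)
  then have "(\<lambda>n. 1 - (s / 2) / ((s / 2 + 1 + of_nat k) + complex_of_nat n)) \<longlonglongrightarrow> 1 - 0"
    by (intro tendsto_diff tendsto_const tendsto_divide_0[OF tendsto_const])
  then have "(\<lambda>n. (1 - (s / 2) / ((s / 2 + 1 + of_nat k) + complex_of_nat n))
      * (exp (s / 2 * of_real (ln (real n))) * beta_mellin s (1 + real n + real k)))
      \<longlonglongrightarrow> (1 - 0) * (Gamma (s / 2) / 2)"
    by (intro tendsto_mult Suc)
  moreover have "(1 - (s / 2) / ((s / 2 + 1 + of_nat k) + complex_of_nat n)) * beta_mellin s (1 + real n + real k)
      = beta_mellin s (1 + real n + real (Suc k))" for n
  proof -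
    define d where "d = (s / 2 + 1 + of_nat k) + complex_of_nat n"
    have "Re d > 0"
      using assms by (simp add: d_def)
    then have "d \<noteq> 0"
      by auto
    moreover have "(d - s / 2) * beta_mellin s (1 + real n + real k) = d * beta_mellin s (1 + real n + real (Suc k))"
      using beta_mellin_rec[OF assms, of "1 + real n + real k"] by (simp add: d_def add_ac)
    ultimately show ?thesis
      unfolding d_def[symmetric] by (simp add: field_simps)
  qed
  ultimately show ?case
    by (simp add: mult.left_commute)
qed

text \<open>The integral is decreasing in \<open>b\<close> for real \<open>s\<close>, so real \<open>b\<close> is squeezed between the integers
  \<open>1\<close> and \<open>1 + k\<close>.\<close>

lemma beta_mellin_LIMSEQ:
  assumes "Re s > 0" "b \<ge> 1"
  shows "(\<lambda>n. exp (s / 2 * of_real (ln (real n))) * beta_mellin s (b + real n)) \<longlonglongrightarrow> Gamma (s / 2) / 2"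
proof -
  define \<sigma> where "\<sigma> = complex_of_real (Re s)"
  define E where "E t n = exp (t / 2 * complex_of_real (ln (real n)))" for t n
  obtain k :: nat where k: "b \<le> 1 + real k"
    using real_arch_simple[of "b - 1"] by (auto simp: algebra_simps)
  have lim: "(\<lambda>n. E t n * beta_mellin t (1 + real n + real k)) \<longlonglongrightarrow> Gamma (t / 2) / 2" if "Re t > 0" for t k
    unfolding E_def by (rule beta_mellin_LIMSEQ_nat[OF that])
  have "(\<lambda>n. Re (E \<sigma> n * beta_mellin \<sigma> (1 + real n + real 0) - E \<sigma> n * beta_mellin \<sigma> (1 + real n + real k)))
      \<longlonglongrightarrow> Re (Gamma (\<sigma> / 2) / 2 - Gamma (\<sigma> / 2) / 2)"
    using assms by (intro tendsto_Re tendsto_diff lim) (auto simp: \<sigma>_def)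
  then have null: "(\<lambda>n. Re (E \<sigma> n * beta_mellin \<sigma> (1 + real n) - E \<sigma> n * beta_mellin \<sigma> (1 + real n + real k)))
      \<longlonglongrightarrow> 0"
    by simp
  have "(\<lambda>n. E s n * beta_mellin s (1 + real n) - E s n * beta_mellin s (b + real n)) \<longlonglongrightarrow> 0"
  proof (rule Lim_null_comparison[OF always_eventually null], rule allI)
    fix n
    \<comment> \<open>As ln n is real, the norm of the exponential depends only on Re s, so the
      comparison sequence at \<sigma> carries the right scale.\<close>
    have E: "E \<sigma> n = of_real (norm (E s n))"
      by (simp add: E_def \<sigma>_def flip: exp_of_real)
    have "norm (beta_mellin s (1 + real n) - beta_mellin s (b + real n))
        \<le> Re (beta_mellin \<sigma> (1 + real n) - beta_mellin \<sigma> (b + real n))"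
      unfolding \<sigma>_def using assms by (intro norm_beta_mellin_diff_le) auto
    moreover have "norm (beta_mellin s (b + real n) - beta_mellin s (1 + real n + real k))
        \<le> Re (beta_mellin \<sigma> (b + real n) - beta_mellin \<sigma> (1 + real n + real k))"
      unfolding \<sigma>_def using assms k by (intro norm_beta_mellin_diff_le) auto
    \<comment> \<open>This makes the second real difference nonnegative, so it may be added to the
      bound for the first; the two then telescope.\<close>
    moreover have "0 \<le> norm (beta_mellin s (b + real n) - beta_mellin s (1 + real n + real k))"
      by simp
    ultimately have "norm (beta_mellin s (1 + real n) - beta_mellin s (b + real n))
        \<le> Re (beta_mellin \<sigma> (1 + real n) - beta_mellin \<sigma> (1 + real n + real k))"
      unfolding minus_complex.sel by linarith
    then have "norm (E s n) * norm (beta_mellin s (1 + real n) - beta_mellin s (b + real n))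
        \<le> norm (E s n) * Re (beta_mellin \<sigma> (1 + real n) - beta_mellin \<sigma> (1 + real n + real k))"
      by (intro mult_left_mono) auto
    then show "norm (E s n * beta_mellin s (1 + real n) - E s n * beta_mellin s (b + real n))
        \<le> Re (E \<sigma> n * beta_mellin \<sigma> (1 + real n) - E \<sigma> n * beta_mellin \<sigma> (1 + real n + real k))"
      unfolding E by (simp add: right_diff_distrib flip: norm_mult)
  qed
  from tendsto_diff[OF lim[OF assms(1), of 0] this] show ?thesis
    by (simp add: E_def)
qed

theorem beta_mellin_Gamma:
  assumes "Re s > 0" "b > 0"
  shows "beta_mellin s b = Gamma (of_real b) * Gamma (s / 2) / (2 * Gamma (s / 2 + of_real b))"
proof -
  define z where "z = s / 2 + complex_of_real b"
  have z: "Re z > 0"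
    using assms by (simp add: z_def)
  \<comment> \<open>n + 1 steps of the recurrence match the symbols of length n + 1 in
    \<open>Gamma_series\<close>, and n! cancels. The shifted start b + 1 meets the condition
    \<open>b \<ge> 1\<close> of \<open>beta_mellin_LIMSEQ\<close>. In product form both sides
    converge without a quotient of sequences.\<close>
  have eq: "beta_mellin s b * Gamma_series z n = Gamma_series (of_real b) n
      * (exp (s / 2 * of_real (ln (real n))) * beta_mellin s (b + 1 + real n))" for n
  proof -
    have nz: "pochhammer z (Suc n) \<noteq> 0" "pochhammer (complex_of_real b) (Suc n) \<noteq> 0"
      using z assms by (intro pochhammer_Re_pos_neq_0; simp)+
    have "pochhammer (of_real b) (Suc n) * beta_mellin s b
        = pochhammer z (Suc n) * beta_mellin s (b + 1 + real n)"
      unfolding z_def using beta_mellin_pochhammer[OF assms, of "Suc n"] by (simp add: add_ac)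
    then have "beta_mellin s b
        = pochhammer z (Suc n) * beta_mellin s (b + 1 + real n) / pochhammer (of_real b) (Suc n)"
      using nz by (simp add: field_simps)
    moreover have "exp (z * of_real (ln (real n)))
        = exp (s / 2 * of_real (ln (real n))) * exp (of_real b * of_real (ln (real n)))"
      by (simp add: z_def distrib_right flip: exp_add)
    ultimately show ?thesis
      using nz by (simp add: Gamma_series_def field_simps)
  qed
  have "(\<lambda>n. beta_mellin s b * Gamma_series z n) \<longlonglongrightarrow> beta_mellin s b * Gamma z"
    by (intro tendsto_mult tendsto_const Gamma_series_LIMSEQ)
  moreover have "(\<lambda>n. Gamma_series (of_real b) n
      * (exp (s / 2 * of_real (ln (real n))) * beta_mellin s (b + 1 + real n)))
      \<longlonglongrightarrow> Gamma (of_real b) * (Gamma (s / 2) / 2)"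
    using assms by (intro tendsto_mult Gamma_series_LIMSEQ beta_mellin_LIMSEQ) auto
  ultimately have "beta_mellin s b * Gamma z = Gamma (of_real b) * (Gamma (s / 2) / 2)"
    unfolding eq by (rule LIMSEQ_unique)
  moreover have "Gamma z \<noteq> 0"
    using z by (auto simp: Gamma_eq_zero_iff elim!: nonpos_Ints_cases)
  ultimately show ?thesis
    by (simp add: z_def field_simps)
qed

section \<open>Termwise integration of the polynomial expansions\<close>

text \<open>Positivity is asked of each Re s + e k, not of Re s. Linearity is therefore applied
  under the indicator, after every x^e (1 - x^2)^j has been absorbed into a kernel of its
  own.\<close>

lemma beta_kernel_sum_integral:
  fixes c :: "nat \<Rightarrow> real"
  assumes "b > 0" and s: "\<And>k. k \<in> A \<Longrightarrow> Re s + real (e k) > 0"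
    and f: "\<And>x. x \<in> {0<..<1} \<Longrightarrow> f x = (\<Sum>k\<in>A. c k * (x ^ e k * (1 - x\<^sup>2) ^ j k))"
  shows "set_integrable lborel {0<..<1} (\<lambda>x. of_real (f x) * beta_kernel s b x)" (is ?int)
    and "(LBINT x:{0<..<1}. of_real (f x) * beta_kernel s b x)
      = (\<Sum>k\<in>A. of_real (c k) * beta_mellin (s + of_nat (e k)) (b + real (j k)))" (is ?eq)
proof -
  let ?g = "\<lambda>k x. of_real (c k) * beta_kernel (s + of_nat (e k)) (b + real (j k)) x"
  have int: "integrable lborel (\<lambda>x. indicator {0<..<1} x *\<^sub>R ?g k x)" if "k \<in> A" for k
    using set_integrable_mult_right[OF set_integrable_beta_kernel[of "s + of_nat (e k)" "b + real (j k)"]]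
      s[OF that] \<open>b > 0\<close> unfolding set_integrable_def by simp
  have eq: "indicator {0<..<1} x *\<^sub>R (of_real (f x) * beta_kernel s b x)
      = (\<Sum>k\<in>A. indicator {0<..<1} x *\<^sub>R ?g k x)" for x :: real
  proof (cases "x \<in> {0<..<1}")
    case True
    have "beta_kernel (s + of_nat (e k)) (b + real (j k)) x
        = of_real (x ^ e k) * (of_real ((1 - x\<^sup>2) ^ j k) * beta_kernel s b x)" for k
      by (simp only: beta_kernel_mult_one_minus_power[OF True] beta_kernel_mult_power[OF True])
    then show ?thesis
      using True by (simp add: f[OF True] sum_distrib_right sum_distrib_left mult_ac)
  qed simp
  show ?int
    unfolding set_integrable_def eq by (intro Bochner_Integration.integrable_sum int)
  have "(LBINT x:{0<..<1}. of_real (f x) * beta_kernel s b x) = (\<Sum>k\<in>A. LBINT x:{0<..<1}. ?g k x)"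
    unfolding set_lebesgue_integral_def eq by (intro Bochner_Integration.integral_sum int)
  then show ?eq
    by (simp add: beta_mellin_def)
qed

lemma mellin_integrand_beta_kernel:
  assumes "x \<in> {0<..<1}"
  shows "mellin_integrand n l s x = of_real (gegenbauer n l x) * beta_kernel s (l / 2 + 1 / 4) x"
proof -
  have "inverse ((1 - x\<^sup>2) powr (3 / 4 - l / 2)) = (1 - x\<^sup>2) powr (l / 2 + 1 / 4 - 1)"
    by (simp flip: powr_minus)
  then show ?thesis
    by (simp only: mellin_integrand_def beta_kernel_def divide_inverse[of "_ * _"] of_real_inverse[symmetric] mult.assoc)
qed

lemma mellin_exponent_pos:
  assumes "if even n then Re s > 0 else Re s > - 1" and "k \<in> {..n div 2}"
  shows "Re s + real (n - 2 * k) > 0"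
proof (cases "even n")
  case False
  then have "1 \<le> n - 2 * k"
    using assms(2) by (elim oddE) auto
  then have "1 \<le> real (n - 2 * k)"
    by simp
  then show ?thesis
    using assms(1) False by simp
qed (use assms(1) in auto)

text \<open>Serves both expansions: \<open>j\<close> is constantly 0 for the monomials and the
  identity for the powers of 1 - x^2.\<close>

lemma gegenbauer_mellin_eqI:
  assumes l: "l > - 1 / 2" and s: "if even n then Re s > 0 else Re s > - 1"
    and f: "\<And>x. gegenbauer n l x = (\<Sum>k\<le>n div 2. c k * (x ^ (n - 2 * k) * (1 - x\<^sup>2) ^ j k))"
  shows "set_integrable lborel {0<..<1} (mellin_integrand n l s)"
    and "gegenbauer_mellin n l s
      = (\<Sum>k\<le>n div 2. of_real (c k) * beta_mellin (s + of_nat (n - 2 * k)) (l / 2 + 1 / 4 + real (j k)))"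
proof -
  have b: "l / 2 + 1 / 4 > 0"
    using l by simp
  note * = beta_kernel_sum_integral[of "l / 2 + 1 / 4" "{..n div 2}" s "\<lambda>k. n - 2 * k" "gegenbauer n l" c j,
      OF b mellin_exponent_pos[OF s] f]
  show "set_integrable lborel {0<..<1} (mellin_integrand n l s)"
    using *(1) by (subst set_integrable_cong[OF refl refl mellin_integrand_beta_kernel])
  have "gegenbauer_mellin n l s
      = (LBINT x:{0<..<1}. of_real (gegenbauer n l x) * beta_kernel s (l / 2 + 1 / 4) x)"
    unfolding gegenbauer_mellin_def
    by (rule set_lebesgue_integral_cong) (auto simp: mellin_integrand_beta_kernel)
  then show "gegenbauer_mellin n l s
      = (\<Sum>k\<le>n div 2. of_real (c k) * beta_mellin (s + of_nat (n - 2 * k)) (l / 2 + 1 / 4 + real (j k)))"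
    using *(2) by simp
qed

lemma gegenbauer_mellin_monomials:
  assumes "l > - 1 / 2" and "if even n then Re s > 0 else Re s > - 1"
  shows "set_integrable lborel {0<..<1} (mellin_integrand n l s)"
    and "gegenbauer_mellin n l s = (\<Sum>r\<le>n div 2.
        (- 1) ^ r * 2 ^ (n - 2 * r) * pochhammer (of_real l) (n - r) / (fact r * fact (n - 2 * r))
          * beta_mellin (s + of_nat (n - 2 * r)) (l / 2 + 1 / 4))"
proof -
  let ?c = "\<lambda>r. (- 1) ^ r * 2 ^ (n - 2 * r) * pochhammer l (n - r) / (fact r * fact (n - 2 * r))"
  have "gegenbauer n l x = (\<Sum>r\<le>n div 2. ?c r * (x ^ (n - 2 * r) * (1 - x\<^sup>2) ^ 0))" for x
    by (simp add: gegenbauer_pochhammer)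
  note * = gegenbauer_mellin_eqI[OF assms this]
  show "set_integrable lborel {0<..<1} (mellin_integrand n l s)"
    by (rule *)
  show "gegenbauer_mellin n l s = (\<Sum>r\<le>n div 2.
        (- 1) ^ r * 2 ^ (n - 2 * r) * pochhammer (of_real l) (n - r) / (fact r * fact (n - 2 * r))
          * beta_mellin (s + of_nat (n - 2 * r)) (l / 2 + 1 / 4))"
    unfolding *(2) by (simp add: pochhammer_of_real)
qed

section \<open>Factoring out M_0 for even and odd degree\<close>

lemma gegenbauer_mellin_0:
  assumes "l > - 1 / 2" "Re s > 0"
  shows "gegenbauer_mellin 0 l s = beta_mellin s (l / 2 + 1 / 4)"
  using gegenbauer_mellin_monomials(2)[of l 0 s] assms by simp

lemma Gamma_add_of_nat:
  fixes z :: complex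
  assumes "Re z > 0"
  shows "Gamma (z + of_nat k) = pochhammer z k * Gamma z"
proof -
  have z: "z \<notin> \<int>\<^sub>\<le>\<^sub>0"
    using assms by (auto elim!: nonpos_Ints_cases)
  then show ?thesis
    by (simp add: pochhammer_Gamma Gamma_eq_zero_iff)
qed

text \<open>An even shift of \<open>s\<close> moves both Gamma arguments that contain
  \<open>s\<close> by the integer k, so each Gamma quotient collapses to a Pochhammer
  symbol.\<close>

lemma beta_mellin_shift:
  assumes "Re s > 0" "b > 0"
  shows "beta_mellin (s + of_nat (2 * k)) b
    = beta_mellin s b * (pochhammer (s / 2) k / pochhammer (s / 2 + of_real b) k)"
proof -
  have "Gamma ((s + of_nat (2 * k)) / 2) = pochhammer (s / 2) k * Gamma (s / 2)"
    using assms Gamma_add_of_nat[of "s / 2" k] by (simp add: add_divide_distrib)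
  moreover have "Gamma ((s + of_nat (2 * k)) / 2 + of_real b)
      = pochhammer (s / 2 + of_real b) k * Gamma (s / 2 + of_real b)"
    using assms Gamma_add_of_nat[of "s / 2 + of_real b" k] by (simp add: add_divide_distrib add_ac)
  ultimately show ?thesis
    using assms by (simp add: beta_mellin_Gamma mult_ac)
qed

text \<open>The polynomial is summed from its leading power down, the target formulas from the
  lowest power up; the reversal turns the exponent 2n - 2r into 2r.\<close>

lemma sum_atMost_rev:
  fixes f :: "nat \<Rightarrow> 'a::comm_monoid_add"
  shows "(\<Sum>r\<le>n. f r) = (\<Sum>r\<le>n. f (n - r))"
  by (rule sum.reindex_bij_witness[of _ "\<lambda>r. n - r" "\<lambda>r. n - r"]) auto

lemma two_mult_diff_diff:
  fixes n r :: nat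
  assumes "r \<le> n"
  shows "2 * n - (n - r) = n + r"
  using assms by simp

text \<open>Common source of the three even formulas, which differ only in how these coefficients
  are rewritten.\<close>

lemma gegenbauer_mellin_even:
  assumes "l > - 1 / 2" "Re s > 0"
  shows "gegenbauer_mellin (2 * n) l s = gegenbauer_mellin 0 l s * (\<Sum>r\<le>n.
      (- 1) ^ (n - r) * 2 ^ (2 * r) * pochhammer (of_real l) (n + r) / (fact (n - r) * fact (2 * r))
        * (pochhammer (s / 2) r / pochhammer ((s + of_real l) / 2 + 1 / 4) r))"
proof -
  have b: "s / 2 + of_real (l / 2 + 1 / 4) = (s + of_real l) / 2 + 1 / 4"
    by (simp add: add_divide_distrib)
  have "gegenbauer_mellin (2 * n) l s = (\<Sum>r\<le>n.
        (- 1) ^ (n - r) * 2 ^ (2 * r) * pochhammer (of_real l) (n + r) / (fact (n - r) * fact (2 * r))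
          * beta_mellin (s + of_nat (2 * r)) (l / 2 + 1 / 4))"
    using assms by (subst gegenbauer_mellin_monomials(2), simp, simp, subst sum_atMost_rev)
      (auto intro!: sum.cong simp: diff_mult_distrib2 two_mult_diff_diff)
  also have "\<dots> = gegenbauer_mellin 0 l s * (\<Sum>r\<le>n.
      (- 1) ^ (n - r) * 2 ^ (2 * r) * pochhammer (of_real l) (n + r) / (fact (n - r) * fact (2 * r))
        * (pochhammer (s / 2) r / pochhammer ((s + of_real l) / 2 + 1 / 4) r))"
    unfolding sum_distrib_left gegenbauer_mellin_0[OF assms]
  proof (rule sum.cong)
    fix r
    have shift: "beta_mellin (s + of_nat (2 * r)) (l / 2 + 1 / 4)
      = beta_mellin s (l / 2 + 1 / 4) * (pochhammer (s / 2) r / pochhammer ((s + of_real l) / 2 + 1 / 4) r)"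
      using beta_mellin_shift[OF assms(2), of "l / 2 + 1 / 4" r] assms(1) by (simp only: b)
    show "(- 1) ^ (n - r) * 2 ^ (2 * r) * pochhammer (of_real l) (n + r) / (fact (n - r) * fact (2 * r))
          * beta_mellin (s + of_nat (2 * r)) (l / 2 + 1 / 4)
      = beta_mellin s (l / 2 + 1 / 4) * ((- 1) ^ (n - r) * 2 ^ (2 * r) * pochhammer (of_real l) (n + r)
          / (fact (n - r) * fact (2 * r))
        * (pochhammer (s / 2) r / pochhammer ((s + of_real l) / 2 + 1 / 4) r))"
      unfolding shift by simp
  qed simp
  finally show ?thesis .
qed

text \<open>The lowest power is now x, hence the base point s + 1; there (s + 1)/2 + l/2 + 1/4
  produces the 3/4.\<close>

lemma gegenbauer_mellin_odd:
  assumes "l > - 1 / 2" "Re s > - 1"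
  shows "gegenbauer_mellin (2 * n + 1) l s = gegenbauer_mellin 0 l (s + 1) * (\<Sum>r\<le>n.
      (- 1) ^ (n - r) * 2 ^ (2 * r + 1) * pochhammer (of_real l) (n + r + 1) / (fact (n - r) * fact (2 * r + 1))
        * (pochhammer ((s + 1) / 2) r / pochhammer ((s + of_real l) / 2 + 3 / 4) r))"
proof -
  have b: "(s + 1) / 2 + of_real (l / 2 + 1 / 4) = (s + of_real l) / 2 + 3 / 4"
    by (simp add: add_divide_distrib)
  have s1: "Re (s + 1) > 0"
    using assms by simp
  have "gegenbauer_mellin (2 * n + 1) l s = (\<Sum>r\<le>n.
        (- 1) ^ (n - r) * 2 ^ (2 * r + 1) * pochhammer (of_real l) (n + r + 1) / (fact (n - r) * fact (2 * r + 1))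
          * beta_mellin (s + of_nat (2 * r + 1)) (l / 2 + 1 / 4))"
    using assms by (subst gegenbauer_mellin_monomials(2), simp, simp, subst sum_atMost_rev)
      (auto intro!: sum.cong simp: diff_mult_distrib2 two_mult_diff_diff Suc_diff_le)
  also have "\<dots> = gegenbauer_mellin 0 l (s + 1) * (\<Sum>r\<le>n.
      (- 1) ^ (n - r) * 2 ^ (2 * r + 1) * pochhammer (of_real l) (n + r + 1) / (fact (n - r) * fact (2 * r + 1))
        * (pochhammer ((s + 1) / 2) r / pochhammer ((s + of_real l) / 2 + 3 / 4) r))"
    unfolding sum_distrib_left gegenbauer_mellin_0[OF assms(1) s1]
  proof (rule sum.cong)
    fix r
    have "s + of_nat (2 * r + 1) = s + 1 + of_nat (2 * r)"
      by simp
    then have shift: "beta_mellin (s + of_nat (2 * r + 1)) (l / 2 + 1 / 4)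
      = beta_mellin (s + 1) (l / 2 + 1 / 4) * (pochhammer ((s + 1) / 2) r / pochhammer ((s + of_real l) / 2 + 3 / 4) r)"
      using beta_mellin_shift[OF s1, of "l / 2 + 1 / 4" r] assms(1) by (simp only: b)
    show "(- 1) ^ (n - r) * 2 ^ (2 * r + 1) * pochhammer (of_real l) (n + r + 1) / (fact (n - r) * fact (2 * r + 1))
          * beta_mellin (s + of_nat (2 * r + 1)) (l / 2 + 1 / 4)
      = beta_mellin (s + 1) (l / 2 + 1 / 4) * ((- 1) ^ (n - r) * 2 ^ (2 * r + 1) * pochhammer (of_real l) (n + r + 1)
          / (fact (n - r) * fact (2 * r + 1))
        * (pochhammer ((s + 1) / 2) r / pochhammer ((s + of_real l) / 2 + 3 / 4) r))"
      unfolding shift by simp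
  qed simp
  finally show ?thesis .
qed

text \<open>Converts one binomial sum into the other term by term. Splitting (a + 1)_n at r, the
  tail cancels against the binomial of lower index n - r, and the factorials leave r!/(a +
  1)_r.\<close>

lemma gchoose_quotient:
  fixes a :: "'a::field_char_0"
  assumes "r \<le> n" and nz: "pochhammer (a + 1) n \<noteq> 0"
  shows "((of_nat n + a) gchoose (n - r)) / (of_nat (n choose r) * ((of_nat n + a) gchoose n))
    = 1 / ((a + of_nat r) gchoose r)"
proof -
  have "pochhammer (a + 1) n = pochhammer (a + 1) r * pochhammer (a + 1 + of_nat r) (n - r)"
    by (rule pochhammer_product[OF assms(1)])
  then have "pochhammer (a + 1) n = pochhammer (a + 1) r * pochhammer (a + of_nat r + 1) (n - r)"
    by (simp add: add_ac)
  moreover have "(of_nat n + a) gchoose (n - r) = pochhammer (a + of_nat r + 1) (n - r) / fact (n - r)"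
    using gchoose_pochhammer[of "a + of_nat r" "n - r"] assms by (simp add: of_nat_diff add_ac)
  moreover have "(of_nat n + a) gchoose n = pochhammer (a + 1) n / fact n"
    using gchoose_pochhammer[of a n] by (simp add: add_ac)
  ultimately show ?thesis
    using assms by (simp add: gchoose_pochhammer binomial_fact)
qed

section \<open>The hypergeometric formula for general degree\<close>

lemma gegenbauer_mellin_hypergeo:
  assumes l: "l > - 1 / 2" and s: "if even n then Re s > 0 else Re s > - 1"
  shows "gegenbauer_mellin n l s =
    pochhammer (2 * of_real l) n * Gamma (of_real l / 2 + 1 / 4) * Gamma ((s + of_nat n) / 2)
      / (2 * fact n * Gamma ((s + of_nat n + of_real l) / 2 + 1 / 4))
      * hypergeo_3F2 (of_real l / 2 + 1 / 4) ((1 - of_nat n) / 2) (- of_nat n / 2)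
          (1 / 2 + of_real l) (1 - (of_nat n + s) / 2) 1"
proof -
  define B where "B = complex_of_real l / 2 + 1 / 4"
  define w where "w = (s + of_nat n) / 2"
  define G where "G = Gamma B * Gamma w / (2 * Gamma (w + B))"
  have wB: "(s + of_nat n + of_real l) / 2 + 1 / 4 = w + B"
    by (simp add: w_def B_def add_divide_distrib)
  have hyper: "hypergeo_3F2 B ((1 - of_nat n) / 2) (- of_nat n / 2) (1 / 2 + of_real l) (1 - w) 1
    = (\<Sum>k\<le>n div 2. pochhammer B k * pochhammer ((1 - of_nat n) / 2) k * pochhammer (- of_nat n / 2) k
          / (pochhammer (1 / 2 + of_real l) k * pochhammer (1 - w) k * fact k))"
  proof (rule hypergeo_3F2_terminating)
    fix k assume "k > n div 2"
    then have "n < 2 * k"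
      by linarith
    then have "pochhammer (- of_nat n :: complex) (2 * k) = 0"
      by (rule pochhammer_of_nat_eq_0_lemma)
    then have "pochhammer (- of_nat n / 2 :: complex) k * pochhammer ((1 - of_nat n) / 2) k = 0"
      using pochhammer_minus_of_nat_double[of k n, where ?'a = complex] by simp
    then show "pochhammer B k * pochhammer ((1 - of_nat n) / 2) k * pochhammer (- of_nat n / 2) k = 0"
      by auto
  qed
  have "gegenbauer n l x = (\<Sum>k\<le>n div 2.
      (- 1) ^ k * pochhammer (2 * l) n / (4 ^ k * fact k * fact (n - 2 * k) * pochhammer (l + 1 / 2) k)
      * (x ^ (n - 2 * k) * (1 - x\<^sup>2) ^ k))" for x
  proof -
    have "(x\<^sup>2 - 1) ^ k = (- 1) ^ k * (1 - x\<^sup>2) ^ k" for k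
      using power_mult_distrib[of "- 1" "1 - x\<^sup>2" k] by simp
    then show ?thesis
      by (simp add: gegenbauer_expansion[OF l] mult_ac)
  qed
  from gegenbauer_mellin_eqI(2)[OF l s this] have
    "gegenbauer_mellin n l s = (\<Sum>k\<le>n div 2. (- 1) ^ k * pochhammer (2 * of_real l) n
        / (4 ^ k * fact k * fact (n - 2 * k) * pochhammer (of_real l + 1 / 2) k)
      * beta_mellin (s + of_nat (n - 2 * k)) (l / 2 + 1 / 4 + real k))"
    using pochhammer_of_real[of "2 * l", where ?'a = complex] pochhammer_of_real[of "l + 1 / 2", where ?'a = complex]
    by simp
  also have "\<dots> = (\<Sum>k\<le>n div 2. (pochhammer (2 * of_real l) n * G / fact n) *
      (pochhammer B k * pochhammer ((1 - of_nat n) / 2) k * pochhammer (- of_nat n / 2) k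
          / (pochhammer (1 / 2 + of_real l) k * pochhammer (1 - w) k * fact k)))"
  proof (rule sum.cong)
    fix k assume k: "k \<in> {..n div 2}"
    then have k2: "2 * k \<le> n"
      by auto
    have half: "(s + of_nat (n - 2 * k)) / 2 = w - of_nat k"
      using k2 by (simp add: w_def of_nat_diff field_simps)
    have "Re (s + of_nat (n - 2 * k)) > 0"
      using mellin_exponent_pos[OF s k] by simp
    moreover have "complex_of_real (l / 2 + 1 / 4 + real k) = B + of_nat k"
      by (simp add: B_def)
    ultimately have "beta_mellin (s + of_nat (n - 2 * k)) (l / 2 + 1 / 4 + real k)
        = Gamma (B + of_nat k) * Gamma (w - of_nat k) / (2 * Gamma (w + B))"
      using l by (subst beta_mellin_Gamma) (auto simp: half)
    moreover have "Gamma (B + of_nat k) = pochhammer B k * Gamma B"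
      by (rule Gamma_add_of_nat) (use l in \<open>auto simp: B_def\<close>)
    moreover have re: "Re (w - of_nat k) > 0"
      using \<open>Re (s + of_nat (n - 2 * k)) > 0\<close> unfolding half[symmetric] by simp
    then have "Gamma w = pochhammer (w - of_nat k) k * Gamma (w - of_nat k)"
      using Gamma_add_of_nat[of "w - of_nat k" k] by simp
    \<comment> \<open>Reversing the order of the factors produces the lower parameter 1 - w; its
      sign matches the one from (x^2 - 1)^k = (-1)^k (1 - x^2)^k.\<close>
    moreover have "pochhammer (w - of_nat k) k = (- 1) ^ k * pochhammer (1 - w) k"
    proof -
      have "w - 1 - of_nat k + 1 = w - of_nat k" "- (w - 1) = 1 - w"
        by simp_all
      then show ?thesis
        using pochhammer_minus'[of "w - 1" k] by metis
    qed
    \<comment> \<open>Consequently (1 - w)_k is nonzero for every k in the sum, even when 1 - w is a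
      nonpositive integer.\<close>
    moreover have "pochhammer (w - of_nat k) k \<noteq> 0"
      using re by (rule pochhammer_Re_pos_neq_0)
    ultimately have "beta_mellin (s + of_nat (n - 2 * k)) (l / 2 + 1 / 4 + real k)
        = (- 1) ^ k * pochhammer B k / pochhammer (1 - w) k * G"
      by (simp add: G_def)
    moreover have "pochhammer ((1 - of_nat n) / 2) k * pochhammer (- of_nat n / 2) k
        = (fact n / (4 ^ k * fact (n - 2 * k)) :: complex)"
      using pochhammer_minus_half[OF k2, where ?'a = complex] by (simp only: mult.commute)
    ultimately show "(- 1) ^ k * pochhammer (2 * of_real l) n
        / (4 ^ k * fact k * fact (n - 2 * k) * pochhammer (of_real l + 1 / 2) k)
      * beta_mellin (s + of_nat (n - 2 * k)) (l / 2 + 1 / 4 + real k)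
      = (pochhammer (2 * of_real l) n * G / fact n) *
      (pochhammer B k * pochhammer ((1 - of_nat n) / 2) k * pochhammer (- of_nat n / 2) k
          / (pochhammer (1 / 2 + of_real l) k * pochhammer (1 - w) k * fact k))"
      by (simp add: add.commute mult_ac)
  qed simp
  also have "\<dots> = (pochhammer (2 * of_real l) n * G / fact n)
      * hypergeo_3F2 B ((1 - of_nat n) / 2) (- of_nat n / 2) (1 / 2 + of_real l) (1 - w) 1"
    unfolding sum_distrib_left[symmetric] hyper ..
  finally have main: "gegenbauer_mellin n l s = (pochhammer (2 * of_real l) n * G / fact n)
      * hypergeo_3F2 B ((1 - of_nat n) / 2) (- of_nat n / 2) (1 / 2 + of_real l) (1 - w) 1" .
  have w2: "(of_nat n + s) / 2 = w"
    by (simp add: w_def add.commute)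
  have "pochhammer (2 * of_real l) n * G / fact n
      = pochhammer (2 * of_real l) n * Gamma B * Gamma w / (2 * fact n * Gamma (w + B))"
    by (simp add: G_def mult_ac)
  then show ?thesis
    unfolding wB w2 B_def[symmetric] w_def[symmetric] main by (rule arg_cong)
qed

section \<open>Binomial sums and 3F2 series for even and odd degree\<close>

lemma gegenbauer_mellin_even_binomial:
  assumes l: "l > - 1 / 2" and s: "Re s > 0"
  shows "gegenbauer_mellin (2 * n) l s = gegenbauer_mellin 0 l s
    * (\<Sum>r\<le>n. (- 1) ^ (n - r) * 2 ^ (2 * r)
         * ((of_nat (n + r) + of_real l - 1) gchoose (n + r)) * of_nat ((n + r) choose (2 * r))
         * (((s - 2) / 2 + of_nat r) gchoose r)
         / (((s + of_real l) / 2 - 3 / 4 + of_nat r) gchoose r))" (is ?th1)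
    and "gegenbauer_mellin (2 * n) l s = gegenbauer_mellin 0 l s
    * (\<Sum>r\<le>n. (- 1) ^ (n - r) * 2 ^ (2 * r)
         * ((of_nat (n + r) + of_real l - 1) gchoose (n + r)) * of_nat ((n + r) choose (2 * r))
         * (((s - 2) / 2 + of_nat r) gchoose r)
         * ((of_nat n + (s + of_real l) / 2 - 3 / 4) gchoose (n - r))
         / (of_nat (n choose r) * ((of_nat n + (s + of_real l) / 2 - 3 / 4) gchoose n)))" (is ?th2)
proof -
  \<comment> \<open>Chosen so that \<open>a + 1\<close> is the base of the lower symbol in
    \<open>gegenbauer_mellin_even\<close>; the binomial of a + r over r is (a + 1)_r / r!.\<close>
  define a where "a = (s + complex_of_real l) / 2 - 3 / 4"
  have a1: "(s + of_real l) / 2 + 1 / 4 = a + 1"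
    by (simp add: a_def)
  have an: "of_nat n + (s + of_real l) / 2 - 3 / 4 = of_nat n + a"
    by (simp add: a_def)
  have "Re (a + 1) > 0"
    using s l by (simp add: a_def field_simps)
  then have nz: "pochhammer (a + 1) n \<noteq> 0"
    by (rule pochhammer_Re_pos_neq_0)
  have gl: "(of_nat (n + r) + of_real l - 1) gchoose (n + r) = pochhammer (complex_of_real l) (n + r) / fact (n + r)" for r
    using gchoose_pochhammer_minus_one[of "n + r" "complex_of_real l"] by simp
  have gs: "((s - 2) / 2 + of_nat r) gchoose r = pochhammer (s / 2) r / fact r" for r
  proof -
    have "(s - 2) / 2 + 1 = s / 2"
      by (simp add: diff_divide_distrib add_divide_distrib)
    then show ?thesis
      by (simp only: gchoose_pochhammer)
  qed
  show th1: ?th1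
    unfolding gegenbauer_mellin_even[OF l s] a1 a_def[symmetric]
  proof (intro arg_cong2[where f = "(*)"] refl sum.cong)
    fix r assume "r \<in> {..n}"
    then have c: "of_nat ((n + r) choose (2 * r)) = (fact (n + r) / (fact (2 * r) * fact (n - r)) :: complex)"
      by (subst binomial_fact) auto
    \<comment> \<open>The factorials (n + r)! and r! brought in by the binomials cancel in
      pairs.\<close>
    show "(- 1) ^ (n - r) * 2 ^ (2 * r) * pochhammer (of_real l) (n + r) / (fact (n - r) * fact (2 * r))
        * (pochhammer (s / 2) r / pochhammer (a + 1) r)
      = (- 1) ^ (n - r) * 2 ^ (2 * r) * ((of_nat (n + r) + of_real l - 1) gchoose (n + r)) * of_nat ((n + r) choose (2 * r))
         * (((s - 2) / 2 + of_nat r) gchoose r) / ((a + of_nat r) gchoose r)"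
      unfolding gl gs c gchoose_pochhammer[of a] by (simp add: mult_ac del: of_nat_add fact_Suc pochhammer_Suc power_Suc)
  qed
  show ?th2
    unfolding th1 an a_def[symmetric]
  proof (intro arg_cong2[where f = "(*)"] refl sum.cong)
    fix r assume "r \<in> {..n}"
    then have "r \<le> n"
      by simp
    from gchoose_quotient[OF this nz]
    have q: "((of_nat n + a) gchoose (n - r)) / (of_nat (n choose r) * ((of_nat n + a) gchoose n))
      = 1 / ((a + of_nat r) gchoose r)" .
    \<comment> \<open>\<open>x\<close> stands for the factors common to both summands; stating this
      for arbitrary \<open>x\<close> lets \<open>q\<close> act inside a left-nested product.\<close>
    have "x * ((of_nat n + a) gchoose (n - r)) / (of_nat (n choose r) * ((of_nat n + a) gchoose n))
        = x / ((a + of_nat r) gchoose r)" for x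
      by (simp only: times_divide_eq_right[symmetric] q mult_1_right)
         (simp only: times_divide_eq_right mult_1_right)
    then show "(- 1) ^ (n - r) * 2 ^ (2 * r) * ((of_nat (n + r) + of_real l - 1) gchoose (n + r)) * of_nat ((n + r) choose (2 * r))
         * (((s - 2) / 2 + of_nat r) gchoose r) / ((a + of_nat r) gchoose r)
      = (- 1) ^ (n - r) * 2 ^ (2 * r) * ((of_nat (n + r) + of_real l - 1) gchoose (n + r)) * of_nat ((n + r) choose (2 * r))
         * (((s - 2) / 2 + of_nat r) gchoose r) * ((of_nat n + a) gchoose (n - r))
         / (of_nat (n choose r) * ((of_nat n + a) gchoose n))"
      by (rule sym)
  qed
qed

lemma gegenbauer_mellin_odd_binomial:
  assumes l: "l > - 1 / 2" and s: "Re s > - 1"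
  shows "gegenbauer_mellin (2 * n + 1) l s = gegenbauer_mellin 0 l (s + 1)
    * (\<Sum>r\<le>n. (- 1) ^ (n - r) * 2 ^ (2 * r + 1)
         * ((of_nat (n + r) + of_real l) gchoose (n + r + 1)) * of_nat ((n + r + 1) choose (2 * r + 1))
         * (((s - 1) / 2 + of_nat r) gchoose r)
         / (((s + of_real l) / 2 - 1 / 4 + of_nat r) gchoose r))" (is ?th1)
    and "gegenbauer_mellin (2 * n + 1) l s = gegenbauer_mellin 0 l (s + 1)
    * (\<Sum>r\<le>n. (- 1) ^ (n - r) * 2 ^ (2 * r + 1)
         * ((of_nat (n + r) + of_real l) gchoose (n + r + 1)) * of_nat ((n + r + 1) choose (2 * r + 1))
         * (((s - 1) / 2 + of_nat r) gchoose r)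
         * ((of_nat n + (s + of_real l) / 2 - 1 / 4) gchoose (n - r))
         / (of_nat (n choose r) * ((of_nat n + (s + of_real l) / 2 - 1 / 4) gchoose n)))" (is ?th2)
proof -
  define a where "a = (s + complex_of_real l) / 2 - 1 / 4"
  have a1: "(s + of_real l) / 2 + 3 / 4 = a + 1"
    by (simp add: a_def)
  have an: "of_nat n + (s + of_real l) / 2 - 1 / 4 = of_nat n + a"
    by (simp add: a_def)
  have "Re (a + 1) > 0"
    using s l by (simp add: a_def field_simps)
  then have nz: "pochhammer (a + 1) n \<noteq> 0"
    by (rule pochhammer_Re_pos_neq_0)
  have gl: "(of_nat (n + r) + of_real l) gchoose (n + r + 1) = pochhammer (complex_of_real l) (n + r + 1) / fact (n + r + 1)" for r
    using gchoose_pochhammer_minus_one[of "n + r + 1" "complex_of_real l"] by (simp add: add_ac)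
  have gs: "((s - 1) / 2 + of_nat r) gchoose r = pochhammer ((s + 1) / 2) r / fact r" for r
  proof -
    have "(s - 1) / 2 + 1 = (s + 1) / 2"
      by (simp add: diff_divide_distrib add_divide_distrib)
    then show ?thesis
      by (simp only: gchoose_pochhammer)
  qed
  show th1: ?th1
    unfolding gegenbauer_mellin_odd[OF l s] a1 a_def[symmetric]
  proof (intro arg_cong2[where f = "(*)"] refl sum.cong)
    fix r assume "r \<in> {..n}"
    then have c: "of_nat ((n + r + 1) choose (2 * r + 1)) = (fact (n + r + 1) / (fact (2 * r + 1) * fact (n - r)) :: complex)"
      by (subst binomial_fact) auto
    show "(- 1) ^ (n - r) * 2 ^ (2 * r + 1) * pochhammer (of_real l) (n + r + 1) / (fact (n - r) * fact (2 * r + 1))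
        * (pochhammer ((s + 1) / 2) r / pochhammer (a + 1) r)
      = (- 1) ^ (n - r) * 2 ^ (2 * r + 1) * ((of_nat (n + r) + of_real l) gchoose (n + r + 1)) * of_nat ((n + r + 1) choose (2 * r + 1))
         * (((s - 1) / 2 + of_nat r) gchoose r) / ((a + of_nat r) gchoose r)"
      unfolding gl gs c gchoose_pochhammer[of a] by (simp add: mult_ac del: of_nat_add fact_Suc pochhammer_Suc power_Suc)
  qed
  show ?th2
    unfolding th1 an a_def[symmetric]
  proof (intro arg_cong2[where f = "(*)"] refl sum.cong)
    fix r assume "r \<in> {..n}"
    then have "r \<le> n"
      by simp
    from gchoose_quotient[OF this nz]
    have q: "((of_nat n + a) gchoose (n - r)) / (of_nat (n choose r) * ((of_nat n + a) gchoose n))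
      = 1 / ((a + of_nat r) gchoose r)" .
    have "x * ((of_nat n + a) gchoose (n - r)) / (of_nat (n choose r) * ((of_nat n + a) gchoose n))
        = x / ((a + of_nat r) gchoose r)" for x
      by (simp only: times_divide_eq_right[symmetric] q mult_1_right)
         (simp only: times_divide_eq_right mult_1_right)
    then show "(- 1) ^ (n - r) * 2 ^ (2 * r + 1) * ((of_nat (n + r) + of_real l) gchoose (n + r + 1)) * of_nat ((n + r + 1) choose (2 * r + 1))
         * (((s - 1) / 2 + of_nat r) gchoose r) / ((a + of_nat r) gchoose r)
      = (- 1) ^ (n - r) * 2 ^ (2 * r + 1) * ((of_nat (n + r) + of_real l) gchoose (n + r + 1)) * of_nat ((n + r + 1) choose (2 * r + 1))
         * (((s - 1) / 2 + of_nat r) gchoose r) * ((of_nat n + a) gchoose (n - r))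
         / (of_nat (n choose r) * ((of_nat n + a) gchoose n))"
      by (rule sym)
  qed
qed

text \<open>Each parameter has one source: (l)_(n+r) = (l)_n (l + n)_r gives l + n, the signed
  quotient n!/(n - r)! gives -n, and 4^r/(2r)! = 1/((1/2)_r r!) gives 1/2.\<close>

lemma gegenbauer_mellin_even_hypergeo:
  assumes l: "l > - 1 / 2" and s: "Re s > 0"
  shows "gegenbauer_mellin (2 * n) l s = (- 1) ^ n * gegenbauer_mellin 0 l s
    * ((of_real l + of_nat n - 1) gchoose n)
    * hypergeo_3F2 (- of_nat n) (of_real l + of_nat n) (s / 2)
        (1 / 2) (of_real l / 2 + s / 2 + 1 / 4) 1"
proof -
  have a: "of_real l / 2 + s / 2 + 1 / 4 = (s + of_real l) / 2 + 1 / 4"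
    by (simp add: add_divide_distrib)
  have gl: "(of_real l + of_nat n - 1) gchoose n = pochhammer (complex_of_real l) n / fact n"
    using gchoose_pochhammer_minus_one[of n "complex_of_real l"] by (simp only: add.commute)
  have hyper: "hypergeo_3F2 (- of_nat n) (of_real l + of_nat n) (s / 2) (1 / 2) ((s + of_real l) / 2 + 1 / 4) 1
    = (\<Sum>k\<le>n. pochhammer (- of_nat n) k * pochhammer (of_real l + of_nat n) k * pochhammer (s / 2) k
        / (pochhammer (1 / 2) k * pochhammer ((s + of_real l) / 2 + 1 / 4) k * fact k))"
    by (rule hypergeo_3F2_terminating) (simp add: pochhammer_of_nat_eq_0_lemma)
  have "(\<Sum>r\<le>n. (- 1) ^ (n - r) * 2 ^ (2 * r) * pochhammer (of_real l) (n + r) / (fact (n - r) * fact (2 * r))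
        * (pochhammer (s / 2) r / pochhammer ((s + of_real l) / 2 + 1 / 4) r))
    = (- 1) ^ n * (pochhammer (of_real l) n / fact n)
      * hypergeo_3F2 (- of_nat n) (of_real l + of_nat n) (s / 2) (1 / 2) ((s + of_real l) / 2 + 1 / 4) 1"
    unfolding hyper sum_distrib_left
  proof (rule sum.cong)
    fix r assume "r \<in> {..n}"
    then have r: "r \<le> n"
      by simp
    have "pochhammer (1 / 2) r * pochhammer ((s + of_real l) / 2 + 1 / 4) r * fact r
      = (pochhammer (1 / 2) r * fact r) * pochhammer ((s + of_real l) / 2 + 1 / 4) r"
      by simp
    then have den: "pochhammer (1 / 2) r * pochhammer ((s + of_real l) / 2 + 1 / 4) r * fact r
      = fact (2 * r) / 4 ^ r * pochhammer ((s + of_real l) / 2 + 1 / 4) r"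
      by (simp only: pochhammer_half_mult_fact)
    have four: "(2 :: complex) ^ (2 * r) = 4 ^ r"
      by (simp add: power_mult)
    show "(- 1) ^ (n - r) * 2 ^ (2 * r) * pochhammer (of_real l) (n + r) / (fact (n - r) * fact (2 * r))
        * (pochhammer (s / 2) r / pochhammer ((s + of_real l) / 2 + 1 / 4) r)
      = (- 1) ^ n * (pochhammer (of_real l) n / fact n)
        * (pochhammer (- of_nat n) r * pochhammer (of_real l + of_nat n) r * pochhammer (s / 2) r
        / (pochhammer (1 / 2) r * pochhammer ((s + of_real l) / 2 + 1 / 4) r * fact r))"
      unfolding den four pochhammer_minus_of_nat[OF r] minus_one_power_diff[OF r] pochhammer_product'
      by (simp add: mult_ac)
  qed simp
  then show ?thesis
    unfolding gegenbauer_mellin_even[OF l s] a gl by (simp only: mult_ac)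
qed

text \<open>Here 4^r/(2r + 1)! = 1/((3/2)_r r!) gives the lower parameter 3/2, and the remaining 2
  of 2^(2r+1) becomes the prefactor.\<close>

lemma gegenbauer_mellin_odd_hypergeo:
  assumes l: "l > - 1 / 2" and s: "Re s > - 1"
  shows "gegenbauer_mellin (2 * n + 1) l s = (- 1) ^ n * 2 * gegenbauer_mellin 0 l (s + 1)
    * of_nat (n + 1) * ((of_real l + of_nat n) gchoose (n + 1))
    * hypergeo_3F2 (- of_nat n) (of_real l + of_nat n + 1) (s / 2 + 1 / 2)
        (3 / 2) ((of_real l + s) / 2 + 3 / 4) 1"
proof -
  have a: "(of_real l + s) / 2 + 3 / 4 = (s + of_real l) / 2 + 3 / 4" "s / 2 + 1 / 2 = (s + 1) / 2"
    by (simp_all add: add_divide_distrib)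
  have "(of_real l + of_nat n) gchoose (n + 1) = pochhammer (complex_of_real l) (n + 1) / fact (n + 1)"
    using gchoose_pochhammer_minus_one[of "n + 1" "complex_of_real l"] by (simp add: add_ac)
  \<comment> \<open>The prefactor n + 1 reduces (n + 1)! to n!, which then cancels the n! in
    (-n)_r.\<close>
  moreover have "fact (n + 1) = (of_nat (n + 1) * fact n :: complex)" "of_nat (n + 1) \<noteq> (0 :: complex)"
    by (simp_all add: of_nat_eq_0_iff del: of_nat_add of_nat_Suc)
  ultimately have gl: "of_nat (n + 1) * ((of_real l + of_nat n) gchoose (n + 1))
      = pochhammer (complex_of_real l) (n + 1) / fact n"
    by (simp del: of_nat_add of_nat_Suc)
  have hyper: "hypergeo_3F2 (- of_nat n) (of_real l + of_nat n + 1) ((s + 1) / 2) (3 / 2) ((s + of_real l) / 2 + 3 / 4) 1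
    = (\<Sum>k\<le>n. pochhammer (- of_nat n) k * pochhammer (of_real l + of_nat n + 1) k * pochhammer ((s + 1) / 2) k
        / (pochhammer (3 / 2) k * pochhammer ((s + of_real l) / 2 + 3 / 4) k * fact k))"
    by (rule hypergeo_3F2_terminating) (simp add: pochhammer_of_nat_eq_0_lemma)
  have "(\<Sum>r\<le>n. (- 1) ^ (n - r) * 2 ^ (2 * r + 1) * pochhammer (of_real l) (n + r + 1)
        / (fact (n - r) * fact (2 * r + 1))
        * (pochhammer ((s + 1) / 2) r / pochhammer ((s + of_real l) / 2 + 3 / 4) r))
    = (- 1) ^ n * 2 * (pochhammer (of_real l) (n + 1) / fact n)
      * hypergeo_3F2 (- of_nat n) (of_real l + of_nat n + 1) ((s + 1) / 2) (3 / 2) ((s + of_real l) / 2 + 3 / 4) 1"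
    unfolding hyper sum_distrib_left
  proof (rule sum.cong)
    fix r assume "r \<in> {..n}"
    then have r: "r \<le> n"
      by simp
    have "pochhammer (3 / 2) r * pochhammer ((s + of_real l) / 2 + 3 / 4) r * fact r
      = (pochhammer (3 / 2) r * fact r) * pochhammer ((s + of_real l) / 2 + 3 / 4) r"
      by simp
    then have den: "pochhammer (3 / 2) r * pochhammer ((s + of_real l) / 2 + 3 / 4) r * fact r
      = fact (2 * r + 1) / 4 ^ r * pochhammer ((s + of_real l) / 2 + 3 / 4) r"
      by (simp only: pochhammer_three_halves_mult_fact)
    have four: "(2 :: complex) ^ (2 * r + 1) = 2 * 4 ^ r"
      by (simp add: power_mult)
    have poch: "pochhammer (complex_of_real l) (n + r + 1)
      = pochhammer (of_real l) (n + 1) * pochhammer (of_real l + of_nat n + 1) r"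
      using pochhammer_product'[of "complex_of_real l" "n + 1" r] by (simp add: add_ac)
    show "(- 1) ^ (n - r) * 2 ^ (2 * r + 1) * pochhammer (of_real l) (n + r + 1)
        / (fact (n - r) * fact (2 * r + 1))
        * (pochhammer ((s + 1) / 2) r / pochhammer ((s + of_real l) / 2 + 3 / 4) r)
      = (- 1) ^ n * 2 * (pochhammer (of_real l) (n + 1) / fact n)
        * (pochhammer (- of_nat n) r * pochhammer (of_real l + of_nat n + 1) r * pochhammer ((s + 1) / 2) r
        / (pochhammer (3 / 2) r * pochhammer ((s + of_real l) / 2 + 3 / 4) r * fact r))"
      unfolding den four poch pochhammer_minus_of_nat[OF r] minus_one_power_diff[OF r]
      by (simp add: mult_ac del: fact_Suc)
  qed simp
  \<comment> \<open>The formula is a left-nested product in which the left side of \<open>gl\<close>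
    is no subterm; \<open>x\<close> and \<open>y\<close> are its neighbouring factors.\<close>
  moreover have regroup: "x * of_nat (n + 1) * ((of_real l + of_nat n) gchoose (n + 1)) * y
      = x * (pochhammer (complex_of_real l) (n + 1) / fact n) * y" for x y
    by (simp only: mult.assoc gl[symmetric])
  ultimately show ?thesis
    unfolding gegenbauer_mellin_odd[OF l s] a regroup by (simp only: mult_ac)
qed

theorem theorem3:
  fixes l :: real
  assumes "l > - 1 / 2" and "l \<noteq> 0"
  shows
   "(\<forall>(n::nat) (s::complex). (if even n then Re s > 0 else Re s > - 1) \<longrightarrow>
        set_integrable lborel {0<..<1} (mellin_integrand n l s))
  \<and> (\<forall>s::complex. Re s > 0 \<longrightarrow>
        gegenbauer_mellin 0 l s =
          Gamma (of_real l / 2 + 1 / 4) * Gamma (s / 2)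
            / (2 * Gamma ((s + of_real l) / 2 + 1 / 4)))
  \<and> (\<forall>(n::nat) (s::complex). Re s > 0 \<longrightarrow>
        gegenbauer_mellin (2 * n) l s =
          gegenbauer_mellin 0 l s *
            (\<Sum>r\<le>n. (- 1) ^ (n - r) * 2 ^ (2 * r)
               * ((of_nat (n + r) + of_real l - 1) gchoose (n + r))
               * of_nat ((n + r) choose (2 * r))
               * (((s - 2) / 2 + of_nat r) gchoose r)
               * ((of_nat n + (s + of_real l) / 2 - 3 / 4) gchoose (n - r))
               / (of_nat (n choose r) * ((of_nat n + (s + of_real l) / 2 - 3 / 4) gchoose n)))
      \<and> gegenbauer_mellin (2 * n) l s =
          gegenbauer_mellin 0 l s *
            (\<Sum>r\<le>n. (- 1) ^ (n - r) * 2 ^ (2 * r)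
               * ((of_nat (n + r) + of_real l - 1) gchoose (n + r))
               * of_nat ((n + r) choose (2 * r))
               * (((s - 2) / 2 + of_nat r) gchoose r)
               / (((s + of_real l) / 2 - 3 / 4 + of_nat r) gchoose r))
      \<and> gegenbauer_mellin (2 * n) l s =
          (- 1) ^ n * gegenbauer_mellin 0 l s * ((of_real l + of_nat n - 1) gchoose n)
            * hypergeo_3F2 (- of_nat n) (of_real l + of_nat n) (s / 2)
                (1 / 2) (of_real l / 2 + s / 2 + 1 / 4) 1)
  \<and> (\<forall>(n::nat) (s::complex). Re s > - 1 \<longrightarrow>
        gegenbauer_mellin (2 * n + 1) l s =
          gegenbauer_mellin 0 l (s + 1) *
            (\<Sum>r\<le>n. (- 1) ^ (n - r) * 2 ^ (2 * r + 1)
               * ((of_nat (n + r) + of_real l) gchoose (n + r + 1))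
               * of_nat ((n + r + 1) choose (2 * r + 1))
               * (((s - 1) / 2 + of_nat r) gchoose r)
               * ((of_nat n + (s + of_real l) / 2 - 1 / 4) gchoose (n - r))
               / (of_nat (n choose r) * ((of_nat n + (s + of_real l) / 2 - 1 / 4) gchoose n)))
      \<and> gegenbauer_mellin (2 * n + 1) l s =
          gegenbauer_mellin 0 l (s + 1) *
            (\<Sum>r\<le>n. (- 1) ^ (n - r) * 2 ^ (2 * r + 1)
               * ((of_nat (n + r) + of_real l) gchoose (n + r + 1))
               * of_nat ((n + r + 1) choose (2 * r + 1))
               * (((s - 1) / 2 + of_nat r) gchoose r)
               / (((s + of_real l) / 2 - 1 / 4 + of_nat r) gchoose r))
      \<and> gegenbauer_mellin (2 * n + 1) l s =
          (- 1) ^ n * 2 * gegenbauer_mellin 0 l (s + 1) * of_nat (n + 1)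
            * ((of_real l + of_nat n) gchoose (n + 1))
            * hypergeo_3F2 (- of_nat n) (of_real l + of_nat n + 1) (s / 2 + 1 / 2)
                (3 / 2) ((of_real l + s) / 2 + 3 / 4) 1)
  \<and> (\<forall>(n::nat) (s::complex). (if even n then Re s > 0 else Re s > - 1) \<longrightarrow>
        gegenbauer_mellin n l s =
          pochhammer (2 * of_real l) n * Gamma (of_real l / 2 + 1 / 4)
            * Gamma ((s + of_nat n) / 2)
            / (2 * fact n * Gamma ((s + of_nat n + of_real l) / 2 + 1 / 4))
            * hypergeo_3F2 (of_real l / 2 + 1 / 4) ((1 - of_nat n) / 2) (- of_nat n / 2)
                (1 / 2 + of_real l) (1 - (of_nat n + s) / 2) 1)"
proof (intro conjI allI impI)
  fix n :: nat and s :: complex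
  assume "if even n then Re s > 0 else Re s > - 1"
  then show "set_integrable lborel {0<..<1} (mellin_integrand n l s)"
    using assms(1) by (rule gegenbauer_mellin_monomials(1)[rotated])
next
  fix s :: complex assume s: "Re s > 0"
  have "s / 2 + of_real (l / 2 + 1 / 4) = (s + of_real l) / 2 + 1 / 4"
    by (simp add: add_divide_distrib)
  then show "gegenbauer_mellin 0 l s =
      Gamma (of_real l / 2 + 1 / 4) * Gamma (s / 2) / (2 * Gamma ((s + of_real l) / 2 + 1 / 4))"
    using assms s beta_mellin_Gamma[of s "l / 2 + 1 / 4"] by (simp only: gegenbauer_mellin_0) simp
next
  fix n :: nat and s :: complex assume s: "Re s > 0"
  show "gegenbauer_mellin (2 * n) l s = gegenbauer_mellin 0 l s *
            (\<Sum>r\<le>n. (- 1) ^ (n - r) * 2 ^ (2 * r)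
               * ((of_nat (n + r) + of_real l - 1) gchoose (n + r))
               * of_nat ((n + r) choose (2 * r))
               * (((s - 2) / 2 + of_nat r) gchoose r)
               * ((of_nat n + (s + of_real l) / 2 - 3 / 4) gchoose (n - r))
               / (of_nat (n choose r) * ((of_nat n + (s + of_real l) / 2 - 3 / 4) gchoose n)))"
    by (rule gegenbauer_mellin_even_binomial(2)[OF assms(1) s])
  show "gegenbauer_mellin (2 * n) l s = gegenbauer_mellin 0 l s *
            (\<Sum>r\<le>n. (- 1) ^ (n - r) * 2 ^ (2 * r)
               * ((of_nat (n + r) + of_real l - 1) gchoose (n + r))
               * of_nat ((n + r) choose (2 * r))
               * (((s - 2) / 2 + of_nat r) gchoose r)
               / (((s + of_real l) / 2 - 3 / 4 + of_nat r) gchoose r))"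
    by (rule gegenbauer_mellin_even_binomial(1)[OF assms(1) s])
  show "gegenbauer_mellin (2 * n) l s =
          (- 1) ^ n * gegenbauer_mellin 0 l s * ((of_real l + of_nat n - 1) gchoose n)
            * hypergeo_3F2 (- of_nat n) (of_real l + of_nat n) (s / 2)
                (1 / 2) (of_real l / 2 + s / 2 + 1 / 4) 1"
    by (rule gegenbauer_mellin_even_hypergeo[OF assms(1) s])
next
  fix n :: nat and s :: complex assume s: "Re s > - 1"
  show "gegenbauer_mellin (2 * n + 1) l s =
          gegenbauer_mellin 0 l (s + 1) *
            (\<Sum>r\<le>n. (- 1) ^ (n - r) * 2 ^ (2 * r + 1)
               * ((of_nat (n + r) + of_real l) gchoose (n + r + 1))
               * of_nat ((n + r + 1) choose (2 * r + 1))
               * (((s - 1) / 2 + of_nat r) gchoose r)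
               * ((of_nat n + (s + of_real l) / 2 - 1 / 4) gchoose (n - r))
               / (of_nat (n choose r) * ((of_nat n + (s + of_real l) / 2 - 1 / 4) gchoose n)))"
    by (rule gegenbauer_mellin_odd_binomial(2)[OF assms(1) s])
  show "gegenbauer_mellin (2 * n + 1) l s =
          gegenbauer_mellin 0 l (s + 1) *
            (\<Sum>r\<le>n. (- 1) ^ (n - r) * 2 ^ (2 * r + 1)
               * ((of_nat (n + r) + of_real l) gchoose (n + r + 1))
               * of_nat ((n + r + 1) choose (2 * r + 1))
               * (((s - 1) / 2 + of_nat r) gchoose r)
               / (((s + of_real l) / 2 - 1 / 4 + of_nat r) gchoose r))"
    by (rule gegenbauer_mellin_odd_binomial(1)[OF assms(1) s])
  show "gegenbauer_mellin (2 * n + 1) l s =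
          (- 1) ^ n * 2 * gegenbauer_mellin 0 l (s + 1) * of_nat (n + 1)
            * ((of_real l + of_nat n) gchoose (n + 1))
            * hypergeo_3F2 (- of_nat n) (of_real l + of_nat n + 1) (s / 2 + 1 / 2)
                (3 / 2) ((of_real l + s) / 2 + 3 / 4) 1"
    by (rule gegenbauer_mellin_odd_hypergeo[OF assms(1) s])
next
  fix n :: nat and s :: complex
  assume "if even n then Re s > 0 else Re s > - 1"
  then show "gegenbauer_mellin n l s =
          pochhammer (2 * of_real l) n * Gamma (of_real l / 2 + 1 / 4)
            * Gamma ((s + of_nat n) / 2)
            / (2 * fact n * Gamma ((s + of_nat n + of_real l) / 2 + 1 / 4))
            * hypergeo_3F2 (of_real l / 2 + 1 / 4) ((1 - of_nat n) / 2) (- of_nat n / 2)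
                (1 / 2 + of_real l) (1 - (of_nat n + s) / 2) 1"
    using assms(1) by (rule gegenbauer_mellin_hypergeo[rotated])
qed

end
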